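(* Consider the problem of minimizing $f(X)=g(\mathcal{A}X)+\langle C,X\rangle$ over the spectrahedron $\mathcal{S}_n$. Suppose strict complementarity holds for this problem and that one of the following conditions holds: (i) $g$ is $\alpha$-strongly convex (with $\alpha>0$) and the optimal solution $X_\star$ is unique; or (ii) the dual matrix $Z_\star$ in the KKT condition has rank $n-1$. Then the problem satisfies quadratic growth with a parameter $\gamma>0$, which can be taken as follows, where $r_\star=\mathrm{rank}(X_\star)$: in case (i), $$\gamma=\min\left\{\frac{\lambda_{n-r_\star}(Z_\star)}{4+8\,\frac{\sigma_{\max}^2(\tilde{\mathcal{A}})}{\sigma_{\min}^2(\tilde{\mathcal{A}}_V)}},\ \frac{\alpha\,\sigma_{\min}^2(\tilde{\mathcal{A}}_V)}{8}\right\},$$ where $\tilde{\mathcal{A}}:\mathbb{S}^n\to\mathbb{R}^{m+1}$ is $\tilde{\mathcal{A}}(X)=\begin{bmatrix}\mathrm{tr}(X)\\ \mathcal{A}(X)\end{bmatrix}$ and $V\in\mathbb{R}^{n\times r_\star}$ is a matrix with orthonormal columns spanning $\mathrm{range}(X_\star)$; in case (ii), $\gamma=\dfrac{\lambda_{n-r_\star}(Z_\star)}{2}$. In addition, in case (ii) the uniqueness of the optimal solution $X_\star$ is implied.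
   Context: Setting. $\mathbb{S}^n$ is the space of real symmetric $n\times n$ matrices with the trace inner product $\langle\cdot,\cdot\rangle$ and Frobenius norm $\|\cdot\|_F$; $\mathbb{R}^m$ carries the dot product. For $A\in\mathbb{S}^n$, $\lambda_i(A)$ is the $i$-th largest eigenvalue. $\mathcal{S}_n=\{X\in\mathbb{S}^n: X\succeq 0,\ \mathrm{tr}(X)=1\}$. $C\in\mathbb{S}^n$, $\mathcal{A}:\mathbb{S}^n\to\mathbb{R}^m$ is linear, and $g:\mathbb{R}^m\to\mathbb{R}$ is convex and differentiable with Lipschitz continuous gradient. The problem is: minimize $f(X):=g(\mathcal{A}X)+\langle C,X\rangle$ subject to $X\in\mathcal{S}_n$. KKT condition: if $X_\star$ is an optimal solution, there are $Z_\star\in\mathbb{S}^n$ and $s_\star\in\mathbb{R}$ (the dual solution, which is unique) with $\nabla f(X_\star)-Z_\star-s_\star I=0$, $\langle Z_\star,X_\star\rangle=0$, $\mathrm{tr}(X_\star)=1$, $Z_\star\succeq0$, $X_\star\succeq 0$. Strict complementarity: for $(X_\star,Z_\star,s_\star)$ satisfying the KKT condition, $\mathrm{rank}(X_\star)+\mathrm{rank}(Z_\star)=n$. Quadratic growth with parameter $\gamma>0$: $f(X)-f(X_\star)\ge\gamma\|X-X_\star\|_F^2$ for every $X\in\mathcal{S}_n$. For a linear map $\mathcal{B}:\mathbb{S}^d\to\mathbb{R}^l$, $\sigma_{\max}(\mathcal{B})=\max_{\|A\|_F=1}\|\mathcal{B}(A)\|_2$ and $\sigma_{\min}(\mathcal{B})=\min_{\|A\|_F=1}\|\mathcal{B}(A)\|_2$.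 For $V\in\mathbb{R}^{d\times r}$, $\mathcal{B}_V:\mathbb{S}^r\to\mathbb{R}^l$ is $\mathcal{B}_V(S)=\mathcal{B}(VSV^\top)$. It is implicit that $\lambda_{n-r_\star}(Z_\star)$ is defined, i.e. $r_\star<n$. *)

theory Defs
  imports "HOL-Analysis.Analysis" "HOL-Computational_Algebra.Polynomial"
begin

text \<open>
  The space of symmetric matrices is the subspace \<open>Sym\<close> of \<^typ>\<open>real^'n^'n\<close>.
  The library's inner product and norm on this type are the trace inner product and
  the Frobenius norm:
\<close>

lemma inner_eq_trace: "X \<bullet> Y = trace (transpose X ** Y)" for X Y :: "real^'n^'n"
  unfolding inner_vec_def trace_def matrix_matrix_mult_def transpose_def
  by (subst sum.swap) simp

lemma norm_eq_sqrt_trace: "norm X = sqrt (trace (transpose X ** X))" for X :: "real^'n^'n"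
  by (simp add: norm_eq_sqrt_inner inner_eq_trace)

definition Sym :: "(real^'n^'n) set" where
  "Sym = {X. transpose X = X}"

definition psd :: "real^'n^'n \<Rightarrow> bool" where
  "psd X \<longleftrightarrow> X \<in> Sym \<and> (\<forall>v. 0 \<le> v \<bullet> (X *v v))"

definition spectrahedron :: "(real^'n^'n) set" where
  "spectrahedron = {X. psd X \<and> trace X = 1}"

definition charpoly :: "real^'n^'n \<Rightarrow> real poly" where
  "charpoly A = det (\<chi> i j. if i = j then [:- (A $ i $ j), 1:] else [:- (A $ i $ j):])"

text \<open>
  \<open>eigval i A\<close> is the \<open>i\<close>-th largest eigenvalue, counted with multiplicity;
  meaningful for \<open>A \<in> Sym\<close> and \<open>1 \<le> i \<le> CARD('n)\<close>.
\<close>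
definition eigval :: "nat \<Rightarrow> real^'n^'n \<Rightarrow> real" where
  "eigval i A = rev (sorted_list_of_multiset (proots (charpoly A))) ! (i - 1)"

text \<open>
  A linear map on the space of symmetric matrices; values outside \<open>Sym\<close> are never used.
\<close>
definition linear_on_Sym :: "(real^'n^'n \<Rightarrow> 'b::real_vector) \<Rightarrow> bool" where
  "linear_on_Sym B \<longleftrightarrow>
     (\<forall>X\<in>Sym. \<forall>Y\<in>Sym. B (X + Y) = B X + B Y) \<and>
     (\<forall>c. \<forall>X\<in>Sym. B (c *\<^sub>R X) = c *\<^sub>R B X)"

text \<open>
  The gradient in the Euclidean space \<open>Sym\<close>: the representing matrix has to be
  symmetric, which makes it unique.
\<close>
definition has_Sym_gradient ::
    "(real^'n^'n \<Rightarrow> real) \<Rightarrow> real^'n^'n \<Rightarrow> real^'n^'n \<Rightarrow> bool" where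
  "has_Sym_gradient f X G \<longleftrightarrow>
     G \<in> Sym \<and> (f has_derivative (\<lambda>H. G \<bullet> H)) (at X within Sym)"

definition objective ::
    "(real^'m \<Rightarrow> real) \<Rightarrow> (real^'n^'n \<Rightarrow> real^'m) \<Rightarrow> real^'n^'n \<Rightarrow> real^'n^'n \<Rightarrow> real" where
  "objective g A C X = g (A X) + C \<bullet> X"

definition optimal_solution :: "(real^'n^'n \<Rightarrow> real) \<Rightarrow> real^'n^'n \<Rightarrow> bool" where
  "optimal_solution f X \<longleftrightarrow> X \<in> spectrahedron \<and> (\<forall>Y\<in>spectrahedron. f X \<le> f Y)"

definition KKT ::
    "(real^'n^'n \<Rightarrow> real) \<Rightarrow> real^'n^'n \<Rightarrow> real^'n^'n \<Rightarrow> real \<Rightarrow> bool" where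
  "KKT f X Z s \<longleftrightarrow>
     (\<exists>G. has_Sym_gradient f X G \<and> G - Z - s *\<^sub>R mat 1 = 0) \<and>
     Z \<bullet> X = 0 \<and> trace X = 1 \<and> psd Z \<and> psd X"

definition strict_complementarity :: "real^'n^'n \<Rightarrow> real^'n^'n \<Rightarrow> bool" where
  "strict_complementarity X Z \<longleftrightarrow> rank X + rank Z = CARD('n)"

definition quadratic_growth ::
    "(real^'n^'n \<Rightarrow> real) \<Rightarrow> real^'n^'n \<Rightarrow> real \<Rightarrow> bool" where
  "quadratic_growth f Xs \<gamma> \<longleftrightarrow>
     \<gamma> > 0 \<and> (\<forall>X\<in>spectrahedron. f X - f Xs \<ge> \<gamma> * (norm (X - Xs))\<^sup>2)"

definition strongly_convex :: "real \<Rightarrow> (real^'m \<Rightarrow> real) \<Rightarrow> bool" where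
  "strongly_convex \<alpha> g \<longleftrightarrow>
     (\<forall>x y. \<forall>t\<in>{0..1}. g (t *\<^sub>R x + (1 - t) *\<^sub>R y)
        \<le> t * g x + (1 - t) * g y - \<alpha> / 2 * t * (1 - t) * (norm (x - y))\<^sup>2)"

text \<open>
  Supremum and infimum over the unit sphere of \<open>Sym\<close>; they are attained
  (compactness) when \<open>B\<close> is linear on \<open>Sym\<close>.
\<close>
definition sigma_max :: "(real^'d^'d \<Rightarrow> real^'l) \<Rightarrow> real" where
  "sigma_max B = (SUP X\<in>{X\<in>Sym. norm X = 1}. norm (B X))"

definition sigma_min :: "(real^'d^'d \<Rightarrow> real^'l) \<Rightarrow> real" where
  "sigma_min B = (INF X\<in>{X\<in>Sym. norm X = 1}. norm (B X))"

definition compress ::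
    "(real^'d^'d \<Rightarrow> real^'l) \<Rightarrow> real^'r^'d \<Rightarrow> real^'r^'r \<Rightarrow> real^'l" where
  "compress B V S = B (V ** S ** transpose V)"

text \<open>\<^typ>\<open>real^('m option)\<close> is \<open>(m+1)\<close>-dimensional; the entry \<open>None\<close> holds the trace.\<close>
definition with_trace :: "(real^'n^'n \<Rightarrow> real^'m) \<Rightarrow> real^'n^'n \<Rightarrow> real^('m option)" where
  "with_trace A X = (\<chi> k. case k of None \<Rightarrow> trace X | Some j \<Rightarrow> A X $ j)"

text \<open>The columns of \<open>V\<close> are an orthonormal basis of the range of \<open>X\<close>, so \<open>CARD('r) = rank X\<close>.\<close>
definition orthonormal_range_basis :: "real^'r^'n \<Rightarrow> real^'n^'n \<Rightarrow> bool" where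
  "orthonormal_range_basis V X \<longleftrightarrow>
     transpose V ** V = mat 1 \<and> span (columns V) = range (\<lambda>v. X *v v)"

end

theory Submission
  imports Defs
begin

text \<open>
  Write \<open>X\<close> for the optimal solution, \<open>Z\<close> for the dual matrix, \<open>s\<close> for the dual scalar and \<open>Y\<close> for an
  arbitrary feasible point. The gradient of \<open>f\<close> at \<open>X\<close> is \<open>Z + s I\<close>, so (strong) convexity of \<open>g\<close>
  gives \<open>f Y - f X \<ge> Z \<bullet> Y + \<alpha>/2 |A Y - A X|\<^sup>2\<close>, with \<open>\<alpha> = 0\<close> in the merely convex case
  (\<open>KKT_growth\<close>). It remains to bound \<open>|Y - X|\<^sup>2\<close> by the two terms on the right.

  In the eigenbasis of \<open>Z\<close>, let \<open>K\<close> be the set of indices of zero eigenvalues. Strict complementarity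
  says that the \<open>K \<times> K\<close> block is exactly the face space of \<open>X\<close>, the symmetric matrices whose range
  lies in the range of \<open>X\<close>. Let \<open>Q Y\<close> be the restriction of \<open>Y\<close> to this block and \<open>t\<close> the part
  of the trace of \<open>Y\<close> outside \<open>K\<close>. Then \<open>Z \<bullet> Y \<ge> \<lambda> t\<close>, where \<open>\<lambda>\<close> is the least positive
  eigenvalue of \<open>Z\<close>, and nonnegativity of the 2 by 2 principal minors of \<open>Y\<close> gives
  \<open>|Y - Q Y|\<^sup>2 \<le> 2 t - t\<^sup>2\<close> (\<open>norm_off_block_le\<close>). Thus \<open>Z \<bullet> Y\<close> controls the distance to the
  face (\<open>face_projection\<close>).

  If \<open>rank Z = n - 1\<close>, the block has size 1, so \<open>Q Y - X\<close> is the single entry \<open>- t\<close> and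
  \<open>|Y - X|\<^sup>2 \<le> 2 t\<close>; this yields the constant \<open>\<lambda>/2\<close>, and quadratic growth implies uniqueness.

  In the strongly convex case, uniqueness of \<open>X\<close> makes the augmented map (trace and \<open>A\<close>) injective on
  the face space (\<open>unique_optimum_injective_on_face\<close>): otherwise \<open>X\<close> could be moved within its face
  without changing the objective. Hence this map is bounded below there by some \<open>\<sigma> > 0\<close>, and
  \<open>\<sigma> |Q Y - X| \<le> |A Y - A X| + M |Y - Q Y|\<close>, with \<open>M\<close> the largest singular
  value, turns the two controlled terms into a bound for the component along the face. The map
  \<open>S \<mapsto> V S V\<^sup>T\<close> allows \<open>\<sigma>\<close> to be the smallest singular value of the compressed map
  (\<open>face_space_parametrization\<close>).

  The eigenvalues enter the statement as ordered roots of the characteristic polynomial. The spectral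
  theorem (\<open>Sym_diagonalizable\<close>) identifies the one with index \<open>n - rank X = rank Z\<close> as \<open>\<lambda>\<close>
  (\<open>eigval_rank_least_positive\<close>).
\<close>

section \<open>The spectral theorem for real symmetric matrices\<close>

lemma inner_matrix_vector_mult: "v \<bullet> (M *v w) = (transpose M *v v) \<bullet> w"
  for M :: "real^'n^'m"
  by (metis dot_lmul_matrix transpose_matrix_vector)

lemma Sym_transpose: "X \<in> Sym \<Longrightarrow> transpose X = X"
  by (simp add: Sym_def)

lemma Sym_inner: "X \<in> Sym \<Longrightarrow> v \<bullet> (X *v w) = (X *v v) \<bullet> w"
  by (simp add: inner_matrix_vector_mult Sym_transpose)

text \<open>
  The first-order condition at the minimum \<open>t = 0\<close> of a quadratic polynomial. The point
  \<open>- b / (1 + \<bar>c\<bar>)\<close> is close enough to 0 for the linear term to dominate.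
\<close>

lemma linear_coeff_eq_0_if_quadratic_nonneg:
  fixes b c :: real
  assumes "\<And>t. 0 \<le> 2 * t * b + t\<^sup>2 * c"
  shows "b = 0"
proof (rule ccontr)
  assume "b \<noteq> 0"
  define e where "e = 1 / (1 + \<bar>c\<bar>)"
  have e: "e > 0" "e * c < 2"
    unfolding e_def by (auto simp: field_simps abs_if)
  have "0 \<le> 2 * (- e * b) * b + (- e * b)\<^sup>2 * c"
    by (rule assms)
  also have "\<dots> = e * b\<^sup>2 * (e * c - 2)"
    by (simp add: power2_eq_square algebra_simps)
  also have "\<dots> < 0"
    using e \<open>b \<noteq> 0\<close> by (intro mult_pos_neg) auto
  finally show False by simp
qed

text \<open>
  A maximizer \<open>v\<close> of the Rayleigh quotient on the unit sphere of \<open>S\<close> is an eigenvector: the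
  residual \<open>r = M v - A v\<close> again lies in \<open>S\<close>, and moving from \<open>v\<close> in the direction \<open>r\<close> cannot
  increase the quotient, which forces \<open>r \<bullet> r = 0\<close>.
\<close>

lemma Sym_eigenvector_in_invariant_subspace:
  fixes A :: "real^'n^'n"
  assumes A: "A \<in> Sym" and S: "subspace S" "S \<noteq> {0}" and inv: "\<And>v. v \<in> S \<Longrightarrow> A *v v \<in> S"
  obtains v c where "v \<in> S" "norm v = 1" "A *v v = c *\<^sub>R v"
proof -
  define K where "K = S \<inter> sphere 0 1"
  have "compact K"
    unfolding K_def by (simp add: closed_Int_compact closed_subspace S)
  moreover obtain u where "u \<in> S" "u \<noteq> 0"
    using S subspace_0 by blast
  then have "u /\<^sub>R norm u \<in> K"
    by (simp add: K_def S subspace_scale)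
  then have "K \<noteq> {}" by blast
  moreover have "continuous_on K (\<lambda>v. v \<bullet> (A *v v))"
    by (intro continuous_intros)
  ultimately obtain v where v: "v \<in> K" and max: "\<And>w. w \<in> K \<Longrightarrow> w \<bullet> (A *v w) \<le> v \<bullet> (A *v v)"
    using continuous_attains_sup by metis
  define M where "M = v \<bullet> (A *v v)"
  have v1: "v \<in> S" "v \<bullet> v = 1" "norm v = 1"
    using v by (auto simp: K_def norm_eq_1)
  have bound: "w \<bullet> (A *v w) \<le> M * (w \<bullet> w)" if "w \<in> S" for w
  proof (cases "w = 0")
    case False
    define u where "u = w /\<^sub>R norm w"
    have "u \<in> K"
      using that False by (simp add: K_def u_def S subspace_scale)
    then have "u \<bullet> (A *v u) \<le> M"
      using max M_def by simp
    moreover have w: "w = norm w *\<^sub>R u"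
      using False by (simp add: u_def)
    then have "w \<bullet> (A *v w) = (norm w)\<^sup>2 * (u \<bullet> (A *v u))"
      by (metis (no_types, lifting) inner_scaleR_left inner_scaleR_right matrix_vector_mult_scaleR mult.assoc power2_eq_square)
    ultimately show ?thesis
      using mult_right_mono[of "u \<bullet> (A *v u)" M "w \<bullet> w"] by (simp add: power2_norm_eq_inner mult.commute)
  qed auto
  define r where "r = M *\<^sub>R v - A *v v"
  have "r \<in> S"
    unfolding r_def using v1 inv S by (simp add: subspace_diff subspace_scale)
  have sym: "v \<bullet> (A *v r) = r \<bullet> (A *v v)"
    using Sym_inner[OF A, of v r] by (simp add: inner_commute)
  \<comment> \<open>The form \<open>M |w|\<^sup>2 - w \<bullet> A w\<close> is nonnegative on \<open>S\<close> and vanishes at \<open>v\<close>.\<close>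
  have "0 \<le> 2 * t * (r \<bullet> r) + t\<^sup>2 * (M * (r \<bullet> r) - r \<bullet> (A *v r))" for t
  proof -
    have "v + t *\<^sub>R r \<in> S"
      using v1 \<open>r \<in> S\<close> S by (simp add: subspace_add subspace_scale)
    then have "0 \<le> M * ((v + t *\<^sub>R r) \<bullet> (v + t *\<^sub>R r)) - (v + t *\<^sub>R r) \<bullet> (A *v (v + t *\<^sub>R r))"
      using bound by simp
    also have "(v + t *\<^sub>R r) \<bullet> (A *v (v + t *\<^sub>R r))
        = M + 2 * t * (r \<bullet> (A *v v)) + t\<^sup>2 * (r \<bullet> (A *v r))"
      by (simp add: matrix_vector_right_distrib matrix_vector_mult_scaleR inner_add_left inner_add_right
          sym M_def power2_eq_square distrib_left)
    also have "(v + t *\<^sub>R r) \<bullet> (v + t *\<^sub>R r) = 1 + 2 * t * (r \<bullet> v) + t\<^sup>2 * (r \<bullet> r)"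
      by (simp add: inner_add_left inner_add_right v1 inner_commute[of v r] power2_eq_square distrib_left)
    also have "M * (1 + 2 * t * (r \<bullet> v) + t\<^sup>2 * (r \<bullet> r))
          - (M + 2 * t * (r \<bullet> (A *v v)) + t\<^sup>2 * (r \<bullet> (A *v r)))
        = 2 * t * (M * (r \<bullet> v) - r \<bullet> (A *v v)) + t\<^sup>2 * (M * (r \<bullet> r) - r \<bullet> (A *v r))"
      by (simp add: right_diff_distrib distrib_left mult_ac)
    also have "M * (r \<bullet> v) - r \<bullet> (A *v v) = r \<bullet> r"
      by (simp add: r_def inner_diff_right)
    finally show ?thesis .
  qed
  then have "r \<bullet> r = 0"
    by (rule linear_coeff_eq_0_if_quadratic_nonneg)
  then show thesis
    using that[of v M] v1 by (simp add: r_def)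
qed

text \<open>
  Induction on the dimension: split off one eigenvector and continue in its orthogonal
  complement inside \<open>S\<close>, which is invariant again because \<open>A\<close> is symmetric.
\<close>

lemma Sym_orthonormal_eigenbasis_of_subspace:
  fixes A :: "real^'n^'n"
  assumes "A \<in> Sym" "subspace S" "\<And>v. v \<in> S \<Longrightarrow> A *v v \<in> S"
  shows "\<exists>B. B \<subseteq> S \<and> span B = S \<and> pairwise orthogonal B \<and>
    (\<forall>v\<in>B. norm v = 1 \<and> (\<exists>c. A *v v = c *\<^sub>R v))"
  using assms(2,3)
proof (induction "dim S" arbitrary: S rule: less_induct)
  case less
  show ?case
  proof (cases "S = {0}")
    case True
    then show ?thesis by (intro exI[of _ "{}"]) auto
  next
    case False
    then obtain v c where v: "v \<in> S" "norm v = 1" "A *v v = c *\<^sub>R v"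
      using Sym_eigenvector_in_invariant_subspace[OF assms(1) less.prems(1)] less.prems(2) by blast
    define T where "T = S \<inter> {w. orthogonal v w}"
    have T: "subspace T"
      unfolding T_def by (intro subspace_inter less.prems subspace_orthogonal_to_vector)
    have "v \<notin> T"
      using v by (auto simp: T_def orthogonal_self)
    then have "T \<subset> S"
      using v by (auto simp: T_def)
    then have "dim T < dim S"
      using T less.prems by (intro dim_psubset) (simp add: span_eq_iff[THEN iffD2])
    moreover have "A *v w \<in> T" if "w \<in> T" for w
      using that less.prems(2) v Sym_inner[OF assms(1), of v w]
      by (auto simp: T_def orthogonal_def)
    ultimately obtain B where B: "B \<subseteq> T" "span B = T" "pairwise orthogonal B"
      "\<forall>v\<in>B. norm v = 1 \<and> (\<exists>c. A *v v = c *\<^sub>R v)"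
      using less.hyps[of T] T by blast
    have "S \<subseteq> span (insert v B)"
    proof
      fix w assume "w \<in> S"
      then have "w - (v \<bullet> w) *\<^sub>R v \<in> T"
        using v less.prems(1)
        by (auto simp: T_def orthogonal_def inner_simps norm_eq_1 subspace_diff subspace_scale)
      then show "w \<in> span (insert v B)"
        using B(2) by (auto simp: span_insert)
    qed
    moreover have "span (insert v B) \<subseteq> S"
      using v B less.prems(1) by (intro span_minimal) (auto simp: T_def)
    moreover have "pairwise orthogonal (insert v B)"
      using B by (auto simp: pairwise_insert T_def orthogonal_commute)
    ultimately show ?thesis
      using B v by (intro exI[of _ "insert v B"]) (auto simp: T_def)
  qed
qed

definition diag :: "('n \<Rightarrow> real) \<Rightarrow> real^'n^'n" where
  "diag d = (\<chi> i j. if i = j then d i else 0)"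

text \<open>
  For orthogonal \<open>U\<close> this is the matrix of the operator \<open>X\<close> in the basis formed by the columns of
  \<open>U\<close>; it preserves the trace inner product, so every estimate below can be made in the eigenbasis
  of the dual matrix.
\<close>

definition conjugate :: "real^'n^'n \<Rightarrow> real^'n^'n \<Rightarrow> real^'n^'n" where
  "conjugate U X = transpose U ** X ** U"

proposition Sym_diagonalizable:
  fixes A :: "real^'n^'n"
  assumes A: "A \<in> Sym"
  obtains U d where "orthogonal_matrix U" "conjugate U A = diag d"
proof -
  obtain B where B: "span B = UNIV" "pairwise orthogonal B"
    "\<forall>v\<in>B. norm v = 1 \<and> (\<exists>c. A *v v = c *\<^sub>R v)"
    using Sym_orthonormal_eigenbasis_of_subspace[OF A, of UNIV] by auto
  have ind: "independent B"
    using B by (intro pairwise_orthogonal_independent) auto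
  then have "card B = CARD('n)" "finite B"
    using B(1) by (metis dim_span dim_UNIV DIM_cart DIM_real mult.right_neutral dim_eq_card_independent)
      (use ind independent_imp_finite in blast)
  then obtain b :: "'n \<Rightarrow> real^'n" where b: "bij_betw b UNIV B"
    by (metis finite_class.finite_UNIV finite_same_card_bij)
  then have bB: "b j \<in> B" for j
    by (auto simp: bij_betw_def)
  obtain d where d: "\<And>j. A *v b j = d j *\<^sub>R b j"
  proof -
    have "\<forall>j. \<exists>c. A *v b j = c *\<^sub>R b j"
      using B(3) bB by blast
    then show ?thesis
      using that unfolding choice_iff by blast
  qed
  define U :: "real^'n^'n" where "U = (\<chi> i j. b j $ i)"
  have orth: "b i \<bullet> b j = (if i = j then 1 else 0)" for i j
  proof -
    have "b i \<noteq> b j" if "i \<noteq> j"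
      using b that by (auto simp: bij_betw_def inj_def)
    then show ?thesis
      using B(2,3) bB[of i] bB[of j] by (auto simp: pairwise_def orthogonal_def norm_eq_1)
  qed
  have "transpose U ** U = mat 1"
    using orth by (simp add: matrix_matrix_mult_def transpose_def U_def vec_eq_iff mat_def inner_vec_def)
  then have "orthogonal_matrix U"
    by (simp add: orthogonal_matrix)
  moreover have "A ** U = (\<chi> i j. d j * b j $ i)"
    using d by (simp add: matrix_matrix_mult_def matrix_vector_mult_def U_def vec_eq_iff)
  then have "conjugate U A $ i $ j = d j * (b i \<bullet> b j)" for i j
    unfolding conjugate_def matrix_mul_assoc[symmetric]
    by (simp add: matrix_matrix_mult_def transpose_def U_def inner_vec_def sum_distrib_left mult_ac)
  then have "conjugate U A = diag d"
    by (simp add: vec_eq_iff diag_def orth)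
  ultimately show thesis by (rule that)
qed

lemma conjugate_mult:
  fixes U :: "real^'n^'n"
  assumes "orthogonal_matrix U"
  shows "conjugate U X ** conjugate U Y = conjugate U (X ** Y)"
proof -
  have "U ** transpose U = mat 1" using assms by (simp add: orthogonal_matrix_def)
  then have "U ** (transpose U ** M) = M" for M :: "real^'n^'n"
    by (simp add: matrix_mul_assoc)
  then show ?thesis
    by (simp add: conjugate_def matrix_mul_assoc[symmetric])
qed

lemma conjugate_conjugate_transpose:
  fixes U :: "real^'n^'n"
  assumes "orthogonal_matrix U"
  shows "conjugate U (conjugate (transpose U) X) = X"
proof -
  have U: "transpose U ** U = mat 1" using assms by (simp add: orthogonal_matrix_def)
  then have "transpose U ** (U ** M) = M" for M :: "real^'n^'n"
    by (simp add: matrix_mul_assoc)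
  then show ?thesis
    by (simp add: conjugate_def matrix_mul_assoc[symmetric] U)
qed

lemma conjugate_transpose_conjugate:
  assumes "orthogonal_matrix U"
  shows "conjugate (transpose U) (conjugate U X) = X"
  using conjugate_conjugate_transpose[of "transpose U" X] assms by simp

lemma transpose_conjugate: "transpose (conjugate U X) = conjugate U (transpose X)"
  by (simp add: conjugate_def matrix_transpose_mul matrix_mul_assoc)

lemma Sym_conjugate: "X \<in> Sym \<Longrightarrow> conjugate U X \<in> Sym"
  by (simp add: Sym_def transpose_conjugate)

lemma trace_conjugate:
  assumes "orthogonal_matrix U"
  shows "trace (conjugate U X) = trace X"
  using assms trace_mul_sym[of "transpose U" "X ** U"]
  by (simp add: conjugate_def matrix_mul_assoc[symmetric] orthogonal_matrix_def)

lemma inner_conjugate: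
  assumes "orthogonal_matrix U"
  shows "conjugate U X \<bullet> conjugate U Y = X \<bullet> Y"
  by (simp add: inner_eq_trace transpose_conjugate conjugate_mult trace_conjugate assms)

lemma linear_conjugate: "linear (conjugate U)" for U :: "real^'a^'a"
proof (rule linearI)
  have "(A + B) ** U = A ** U + B ** U" for A B :: "real^'a^'a"
    by (simp add: matrix_matrix_mult_def vec_eq_iff sum.distrib distrib_right)
  then show "conjugate U (X + Y) = conjugate U X + conjugate U Y" for X Y
    by (simp add: conjugate_def matrix_add_ldistrib)
  show "conjugate U (c *\<^sub>R X) = c *\<^sub>R conjugate U X" for c X
    by (simp add: conjugate_def matrix_scalar_ac flip: scalar_matrix_assoc)
qed

lemma conjugate_diff: "conjugate U (X - Y) = conjugate U X - conjugate U Y"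
  by (rule linear_diff[OF linear_conjugate])

lemma norm_conjugate:
  assumes "orthogonal_matrix U"
  shows "norm (conjugate U X) = norm X"
  by (simp add: norm_eq_sqrt_inner inner_conjugate assms)

lemma conjugate_vector_mult:
  fixes U :: "real^'n^'n"
  assumes "orthogonal_matrix U"
  shows "conjugate U X *v (transpose U *v v) = transpose U *v (X *v v)"
proof -
  have "U *v (transpose U *v v) = v"
    using assms by (simp add: matrix_vector_mul_assoc orthogonal_matrix_def del: transpose_matrix_vector)
  then show ?thesis
    by (simp add: conjugate_def del: transpose_matrix_vector flip: matrix_vector_mul_assoc)
qed

lemma psd_conjugate:
  assumes "psd X" shows "psd (conjugate U X)"
proof -
  have "v \<bullet> (conjugate U X *v v) = (U *v v) \<bullet> (X *v (U *v v))" for v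
    using inner_matrix_vector_mult[of v "transpose U" "X *v (U *v v)"]
    by (simp add: conjugate_def del: transpose_matrix_vector flip: matrix_vector_mul_assoc)
  then show ?thesis
    using assms by (simp add: psd_def Sym_conjugate)
qed

lemma rank_conjugate:
  assumes "orthogonal_matrix U"
  shows "rank (conjugate U X) = rank X"
proof -
  have le: "rank (conjugate W Y) \<le> rank Y" for W Y :: "real^'n^'n"
    unfolding conjugate_def using rank_mul_le_left rank_mul_le_right order_trans by blast
  show ?thesis
    using le[of U X] le[of "transpose U" "conjugate U X"] conjugate_transpose_conjugate[OF assms, of X]
    by simp
qed

lemma diag_vector_mult: "diag d *v w = (\<chi> i. d i * w $ i)"
proof -
  have "(\<Sum>j\<in>UNIV. (if i = j then d i else 0) * w $ j) = d i * w $ i" for i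
    by (subst sum.remove[of _ i]) auto
  then show ?thesis
    by (simp add: diag_def matrix_vector_mult_def vec_eq_iff)
qed

lemma range_diag: "range ((*v) (diag d)) = {x :: real^'n. \<forall>i. i \<notin> {i. d i \<noteq> 0} \<longrightarrow> x $ i = 0}"
proof (intro set_eqI iffI)
  fix x :: "real^'n" assume x: "x \<in> {x. \<forall>i. i \<notin> {i. d i \<noteq> 0} \<longrightarrow> x $ i = 0}"
  have "x = diag d *v (\<chi> i. x $ i / d i)"
    using x by (auto simp: diag_vector_mult vec_eq_iff)
  then show "x \<in> range ((*v) (diag d))" by blast
qed (auto simp: diag_vector_mult)

lemma rank_diag: "rank (diag d) = card {i. d i \<noteq> 0}"
  by (simp only: rank_dim_range range_diag dim_substandard_cart flip: dim_vec_eq)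

section \<open>Eigenvalues from the characteristic polynomial\<close>

lemma poly_charpoly: "poly (charpoly A) x = det (x *\<^sub>R mat 1 - A)"
proof -
  have "poly (if i = j then [:- (A $ i $ j), 1:] else [:- (A $ i $ j):]) x = (x *\<^sub>R mat 1 - A) $ i $ j" for i j
    by (simp add: mat_def)
  then show ?thesis
    by (simp add: charpoly_def det_def poly_sum poly_prod)
qed

lemma charpoly_diagonalized:
  assumes U: "orthogonal_matrix U" and d: "conjugate U A = diag d"
  shows "charpoly A = (\<Prod>i\<in>UNIV. [:- d i, 1:])"
proof -
  have "poly (charpoly A) x = poly (\<Prod>i\<in>UNIV. [:- d i, 1:]) x" for x
  proof -
    have UU: "transpose U ** U = mat 1" and "det U * det U = 1"
      using U det_orthogonal_matrix[OF U] by (auto simp: orthogonal_matrix_def)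
    then have "det (x *\<^sub>R mat 1 - A) = det (conjugate U (x *\<^sub>R mat 1 - A))"
      by (simp add: conjugate_def det_mul det_transpose)
    also have "conjugate U (x *\<^sub>R mat 1 - A) = diag (\<lambda>i. x - d i)"
    proof -
      have "conjugate U (x *\<^sub>R mat 1) = x *\<^sub>R mat 1"
        by (simp add: linear_scale[OF linear_conjugate] conjugate_def[of _ "mat 1"] UU)
      then show ?thesis
        by (simp add: conjugate_diff d) (simp add: diag_def vec_eq_iff mat_def)
    qed
    also have "det \<dots> = (\<Prod>i\<in>UNIV. x - d i)"
      by (subst det_diagonal) (auto simp: diag_def)
    finally show ?thesis
      by (simp add: poly_charpoly poly_prod)
  qed
  then show ?thesis by (auto simp: poly_eq_poly_eq_iff[symmetric])
qed

text \<open>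
  This is how an index into the ordered list of eigenvalues is turned into an extremal property:
  in a descending list with \<open>r\<close> positive entries these are exactly the first \<open>r\<close> ones.
\<close>

lemma last_positive_of_descending_list:
  fixes L :: "real list"
  assumes desc: "sorted (rev L)" and r: "r = length (filter (\<lambda>x. 0 < x) L)" "0 < r"
  shows "0 < L ! (r - 1)" and "x \<in> set L \<Longrightarrow> 0 < x \<Longrightarrow> L ! (r - 1) \<le> x"
proof -
  define P where "P = {k. k < length L \<and> 0 < L ! k}"
  have card: "card P = r" and "finite P"
    using r by (auto simp: length_filter_conv_card P_def)
  have rL: "r \<le> length L"
    using r by simp
  show pos: "0 < L ! (r - 1)"
  proof (rule ccontr)
    assume neg: "\<not> 0 < L ! (r - 1)"
    have "P \<subseteq> {..<r - 1}"
    proof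
      fix k assume k: "k \<in> P"
      show "k \<in> {..<r - 1}"
      proof (rule ccontr)
        assume "k \<notin> {..<r - 1}"
        then have "L ! k \<le> L ! (r - 1)"
          using sorted_rev_nth_mono[OF desc, of "r - 1" k] k by (auto simp: P_def)
        then show False using neg k by (auto simp: P_def)
      qed
    qed
    then have "card P \<le> r - 1"
      using card_mono[of "{..<r - 1}" P] by simp
    then show False using card r by simp
  qed
  show "L ! (r - 1) \<le> x" if x: "x \<in> set L" "0 < x"
  proof -
    obtain k where k: "k < length L" "x = L ! k"
      using x by (auto simp: in_set_conv_nth)
    have "k < r"
    proof (rule ccontr)
      assume "\<not> k < r"
      have "{..k} \<subseteq> P"
      proof
        fix j assume j: "j \<in> {..k}"
        then have "L ! k \<le> L ! j"
          using sorted_rev_nth_mono[OF desc, of j k] k by auto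
        then show "j \<in> P" using j k x by (auto simp: P_def)
      qed
      then have "Suc k \<le> card P"
        using card_mono[OF \<open>finite P\<close>, of "{..k}"] by simp
      then show False using card \<open>\<not> k < r\<close> by simp
    qed
    then have "k \<le> r - 1" "r - 1 < length L"
      using rL by linarith+
    then show ?thesis
      using sorted_rev_nth_mono[OF desc, of k "r - 1"] k by simp
  qed
qed

lemma axis_form: "axis i a \<bullet> (X *v axis j b) = a * b * X $ i $ j" for X :: "real^'n^'n"
proof -
  have "(X *v axis j b) $ i = b * X $ i $ j"
    unfolding matrix_vector_mult_def axis_def
    by simp (subst sum.remove[of _ j], auto)
  then show ?thesis
    by (simp add: inner_axis inner_commute[of "axis i a"])
qed

lemma psd_diagonal_nonneg: "psd X \<Longrightarrow> 0 \<le> X $ i $ i"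
  using axis_form[of i 1 X i 1] by (simp add: psd_def) (metis axis_form mult_1)

text \<open>
  The rank counts the nonzero eigenvalues, so for a positive semidefinite matrix the eigenvalue
  whose index is the rank is the smallest positive one. Applied to the dual matrix \<open>Z\<close>, this is
  the meaning of \<open>\<lambda>\<close> with index \<open>n - r\<close> under strict complementarity.
\<close>

proposition eigval_rank_least_positive:
  fixes A :: "real^'n^'n"
  assumes A: "psd A" and U: "orthogonal_matrix U" and d: "conjugate U A = diag d"
    and rank: "0 < rank A"
  shows "0 \<le> d i" and "0 < eigval (rank A) A"
    and "d i \<noteq> 0 \<Longrightarrow> eigval (rank A) A \<le> d i"
proof -
  have nonneg: "0 \<le> d i" for i
    using psd_diagonal_nonneg[OF psd_conjugate[OF A, of U], of i] by (simp add: d diag_def)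
  then show "0 \<le> d i" .
  define L where "L = rev (sorted_list_of_multiset (proots (charpoly A)))"
  have "proots (charpoly A) = (\<Sum>i\<in>UNIV. {#d i#})"
    by (simp add: charpoly_diagonalized[OF U d] proots_prod)
  also have "\<dots> = image_mset d (mset_set UNIV)"
    by (simp add: sum_unfold_sum_mset) 
  finally have L: "mset L = image_mset d (mset_set UNIV)"
    by (simp add: L_def)
  have "rank A = card {i. d i \<noteq> 0}"
    using rank_conjugate[OF U, of A] by (simp add: d rank_diag)
  also have "{i. d i \<noteq> 0} = {i. 0 < d i}"
    using nonneg by (auto simp: less_le)
  also have "card \<dots> = size (filter_mset (\<lambda>x. 0 < x) (mset L))"
    by (simp add: L filter_mset_image_mset)
  finally have r: "rank A = length (filter (\<lambda>x. 0 < x) L)"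
    by (metis mset_filter size_mset)
  have "sorted (rev L)"
    by (simp add: L_def)
  note * = last_positive_of_descending_list[OF this r rank]
  have e: "eigval (rank A) A = L ! (rank A - 1)"
    by (simp add: eigval_def L_def)
  show "0 < eigval (rank A) A"
    using *(1) by (simp add: e)
  have "d i \<in> set L"
    using L by (metis finite_class.finite_UNIV finite_set_mset_mset_set image_eqI set_image_mset set_mset_mset UNIV_I)
  then show "eigval (rank A) A \<le> d i" if "d i \<noteq> 0"
    using *(2) that nonneg[of i] by (simp add: e less_le)
qed

section \<open>Entries of positive semidefinite matrices\<close>

text \<open>
  The quadratic form at the vector with entries \<open>- X\<^sub>i\<^sub>j\<close> and \<open>X\<^sub>i\<^sub>i\<close> in the positions \<open>i\<close> and \<open>j\<close> is
  \<open>X\<^sub>i\<^sub>i\<close> times the principal minor, and likewise with \<open>i\<close> and \<open>j\<close> exchanged; if both diagonal entries vanish, the form is linear in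
  \<open>X\<^sub>i\<^sub>j\<close> and takes both signs unless that entry is 0.
\<close>

lemma psd_minor_nonneg:
  assumes "psd X" shows "(X $ i $ j)\<^sup>2 \<le> X $ i $ i * X $ j $ j"
proof -
  have sym: "X $ j $ i = X $ i $ j"
    using assms by (simp add: psd_def Sym_def transpose_def vec_eq_iff)
  have form: "0 \<le> a\<^sup>2 * X $ i $ i + 2 * a * b * X $ i $ j + b\<^sup>2 * X $ j $ j" for a b
  proof -
    have "0 \<le> (axis i a + axis j b) \<bullet> (X *v (axis i a + axis j b))"
      using assms by (simp add: psd_def)
    then show ?thesis
      by (simp add: matrix_vector_right_distrib inner_add_left inner_add_right axis_form sym
          power2_eq_square algebra_simps)
  qed
  have ii: "0 \<le> X $ i $ i" and jj: "0 \<le> X $ j $ j"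
    using assms by (auto intro: psd_diagonal_nonneg)
  consider "0 < X $ i $ i" | "0 < X $ j $ j" | "X $ i $ i = 0" "X $ j $ j = 0"
    using ii jj by linarith
  then show ?thesis
  proof cases
    case 1
    have "0 \<le> X $ i $ i * (X $ i $ i * X $ j $ j - (X $ i $ j)\<^sup>2)"
      using form[of "- (X $ i $ j)" "X $ i $ i"] by (simp add: power2_eq_square algebra_simps)
    with 1 show ?thesis by (simp add: zero_le_mult_iff)
  next
    case 2
    have "0 \<le> X $ j $ j * (X $ i $ i * X $ j $ j - (X $ i $ j)\<^sup>2)"
      using form[of "X $ j $ j" "- (X $ i $ j)"] by (simp add: power2_eq_square algebra_simps)
    with 2 show ?thesis by (simp add: zero_le_mult_iff)
  next
    case 3
    then show ?thesis
      using form[of 1 1] form[of 1 "-1"] by simp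
  qed
qed

lemma inner_matrix_entries: "X \<bullet> Y = (\<Sum>(i, j)\<in>UNIV. X $ i $ j * Y $ i $ j)"
  for X Y :: "real^'n^'m"
  by (simp add: inner_vec_def sum.cartesian_product UNIV_Times_UNIV[symmetric] del: UNIV_Times_UNIV)

lemma norm_matrix_entries: "(norm X)\<^sup>2 = (\<Sum>(i, j)\<in>UNIV. (X $ i $ j)\<^sup>2)"
  for X :: "real^'n^'m"
  by (simp add: power2_norm_eq_inner inner_matrix_entries) (simp add: power2_eq_square)

definition block :: "'n set \<Rightarrow> real^'n^'n \<Rightarrow> real^'n^'n" where
  "block K X = (\<chi> i j. if i \<in> K \<and> j \<in> K then X $ i $ j else 0)"

text \<open>
  The maps that keep or delete the entries outside \<open>K \<times> K\<close> are complementary orthogonal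
  projections for the Frobenius inner product.
\<close>

lemma block_pythagoras:
  assumes "block K Y = Y"
  shows "(norm (X - Y))\<^sup>2 = (norm (X - block K X))\<^sup>2 + (norm (block K X - Y))\<^sup>2"
proof -
  have "Y $ i $ j = 0" if "\<not> (i \<in> K \<and> j \<in> K)" for i j
  proof -
    have "Y $ i $ j = block K Y $ i $ j" using assms by simp
    then show ?thesis using that by (simp add: block_def)
  qed
  then have "(X $ i $ j - Y $ i $ j)\<^sup>2 =
      (X $ i $ j - block K X $ i $ j)\<^sup>2 + (block K X $ i $ j - Y $ i $ j)\<^sup>2" for i j
    by (auto simp: block_def)
  then show ?thesis
    by (simp add: norm_matrix_entries split_beta flip: sum.distrib)
qed

text \<open>
  The key estimate: the deleted part of a density matrix is controlled by the trace \<open>t\<close> that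
  sits outside \<open>K\<close>, and its squared norm is at most linear in \<open>t\<close>. Each squared entry is at most the product
  of the two diagonal entries, and summing these products over the complement of \<open>K \<times> K\<close>
  gives \<open>1 - (1 - t)\<^sup>2\<close>.
\<close>

lemma norm_off_block_le:
  fixes K :: "('n::finite) set" and X :: "real^'n^'n"
  assumes X: "psd X" "trace X = 1"
  defines "t \<equiv> \<Sum>i\<in>-K. X $ i $ i"
  shows "(norm (X - block K X))\<^sup>2 \<le> 2 * t - t\<^sup>2"
proof -
  have "(\<Sum>i\<in>UNIV. X $ i $ i) = (\<Sum>i\<in>K. X $ i $ i) + t"
    unfolding t_def by (subst sum.union_disjoint[symmetric]) (auto intro: sum.cong)
  then have K: "(\<Sum>i\<in>K. X $ i $ i) = 1 - t"
    using X(2) by (simp add: trace_def)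
  have "(norm (X - block K X))\<^sup>2 = (\<Sum>p\<in>UNIV - K \<times> K. (X $ fst p $ snd p)\<^sup>2)"
    unfolding norm_matrix_entries split_beta
    by (rule sum.mono_neutral_cong_right) (auto simp: block_def)
  also have "\<dots> \<le> (\<Sum>p\<in>UNIV - K \<times> K. X $ fst p $ fst p * X $ snd p $ snd p)"
    by (intro sum_mono psd_minor_nonneg X)
  also have "\<dots> = (\<Sum>p\<in>UNIV. X $ fst p $ fst p * X $ snd p $ snd p)
      - (\<Sum>p\<in>K \<times> K. X $ fst p $ fst p * X $ snd p $ snd p)"
    by (intro sum_diff) auto
  also have "(\<Sum>p\<in>UNIV. X $ fst p $ fst p * X $ snd p $ snd p) = (trace X)\<^sup>2"
    by (simp add: trace_def power2_eq_square sum_product sum.cartesian_product split_beta)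
  also have "(\<Sum>p\<in>K \<times> K. X $ fst p $ fst p * X $ snd p $ snd p) = (1 - t)\<^sup>2"
    by (simp add: power2_eq_square sum_product sum.cartesian_product split_beta flip: K)
  finally show ?thesis
    using X(2) by (simp add: power2_diff)
qed

section \<open>The face of the cone generated by a positive semidefinite matrix\<close>

text \<open>
  The linear span of the smallest face of the cone of positive semidefinite matrices that contains
  \<open>X\<close>. For symmetric \<open>X\<close> the inclusion of kernels says the same as \<open>range D \<subseteq> range X\<close>, and it
  avoids a choice of basis.
\<close>

definition face_space :: "real^'n^'n \<Rightarrow> (real^'n^'n) set" where
  "face_space X = {D \<in> Sym. \<forall>v. X *v v = 0 \<longrightarrow> D *v v = 0}"

lemma subspace_Sym: "subspace Sym"
  by (auto simp: subspace_def Sym_def transpose_def vec_eq_iff)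

lemma subspace_face_space: "subspace (face_space X)"
  using subspace_Sym
  by (auto simp: subspace_def face_space_def matrix_vector_mult_add_rdistrib
      simp flip: scaleR_matrix_vector_assoc)

text \<open>
  The spectral gap above the kernel: on the orthogonal complement of its kernel, a positive
  semidefinite form dominates its least positive eigenvalue times the squared norm. The vector \<open>p\<close>
  collects the components of \<open>v\<close> along eigenvectors with nonzero eigenvalue.
\<close>

proposition psd_spectral_gap:
  assumes A: "psd A" and rank: "0 < rank A"
  obtains p k where "v = p + k" "A *v k = 0"
    "eigval (rank A) A * (norm p)\<^sup>2 \<le> v \<bullet> (A *v v)"
proof -
  obtain U d where U: "orthogonal_matrix U" and d: "conjugate U A = diag d"
    using Sym_diagonalizable A unfolding psd_def by blast
  note ev = eigval_rank_least_positive[OF A U d rank]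
  have UU: "transpose U ** U = mat 1" "U ** transpose U = mat 1"
    using U by (auto simp: orthogonal_matrix_def)
  define w where "w = transpose U *v v"
  define p' k' :: "real^'a" where
    "p' = (\<chi> i. if d i \<noteq> 0 then w $ i else 0)" and "k' = (\<chi> i. if d i \<noteq> 0 then 0 else w $ i)"
  have tU: "transpose U *v (U *v x) = x" and Ut: "U *v (transpose U *v x) = x" for x
    using UU by (simp_all add: matrix_vector_mul_assoc del: transpose_matrix_vector)
  have A_U: "A *v (U *v x) = U *v (diag d *v x)" for x
  proof -
    have "diag d *v x = transpose U *v (A *v (U *v x))"
      using conjugate_vector_mult[OF U, of A "U *v x"] d by (simp add: tU del: transpose_matrix_vector)
    then show ?thesis by (simp add: Ut del: transpose_matrix_vector)
  qed
  have iso: "(U *v x) \<bullet> (U *v y) = x \<bullet> y" for x y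
    by (simp add: inner_matrix_vector_mult tU del: transpose_matrix_vector)
  have v: "v = U *v w"
    by (simp add: w_def Ut del: transpose_matrix_vector)
  show thesis
  proof
    have "w = p' + k'"
      by (simp add: p'_def k'_def vec_eq_iff)
    then show "v = U *v p' + U *v k'"
      by (simp add: v matrix_vector_right_distrib)
    have "diag d *v k' = 0"
      by (simp add: diag_vector_mult k'_def vec_eq_iff)
    then show "A *v (U *v k') = 0"
      by (simp add: A_U)
    have "eigval (rank A) A * (norm (U *v p'))\<^sup>2 = (\<Sum>i\<in>UNIV. eigval (rank A) A * (p' $ i)\<^sup>2)"
      unfolding power2_norm_eq_inner iso
      by (simp add: inner_vec_def sum_distrib_left power2_eq_square)
    also have "\<dots> \<le> (\<Sum>i\<in>UNIV. d i * (w $ i)\<^sup>2)"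
      using ev(1,3) by (intro sum_mono) (auto simp: p'_def intro: mult_right_mono)
    also have "\<dots> = v \<bullet> (A *v v)"
      unfolding v A_U iso by (simp add: diag_vector_mult inner_vec_def power2_eq_square mult_ac)
    finally show "eigval (rank A) A * (norm (U *v p'))\<^sup>2 \<le> v \<bullet> (A *v v)" .
  qed
qed

text \<open>
  \<open>X\<close> lies in the relative interior of its face: a direction \<open>D\<close> that vanishes on the kernel of
  \<open>X\<close> only sees the component \<open>p\<close> of a vector, and there the spectral gap of \<open>X\<close> absorbs a small
  multiple of \<open>D\<close>.
\<close>

lemma psd_perturb_in_face:
  assumes X: "psd X" and rank: "0 < rank X" and D: "D \<in> face_space X"
  obtains e where "0 < e" "psd (X + e *\<^sub>R D)"
proof -
  define l where "l = eigval (rank X) X"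
  obtain U d where U: "orthogonal_matrix U" "conjugate U X = diag d"
    using Sym_diagonalizable X unfolding psd_def by blast
  have l: "0 < l"
    unfolding l_def by (rule eigval_rank_least_positive[OF X U rank])
  define b where "b = onorm ((*v) D)"
  have b: "norm (D *v v) \<le> b * norm v" for v
    unfolding b_def by (intro onorm matrix_vector_mul_bounded_linear)
  have "0 \<le> b"
    unfolding b_def by (intro onorm_pos_le matrix_vector_mul_bounded_linear)
  define e where "e = l / (b + 1)"
  have e: "0 < e" "e * b \<le> l"
    using l \<open>0 \<le> b\<close> by (auto simp: e_def field_simps)
  have Dsym: "D \<in> Sym" and Dk: "\<And>v. X *v v = 0 \<Longrightarrow> D *v v = 0"
    using D by (auto simp: face_space_def)
  have "0 \<le> v \<bullet> ((X + e *\<^sub>R D) *v v)" for v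
  proof -
    obtain p k where v: "v = p + k" and k: "X *v k = 0" and p: "l * (norm p)\<^sup>2 \<le> v \<bullet> (X *v v)"
      using psd_spectral_gap[OF X rank, of v] l_def by metis
    have "v \<bullet> (D *v v) = p \<bullet> (D *v p)"
      using Sym_inner[OF Dsym, of k p]
      by (simp add: v matrix_vector_right_distrib Dk[OF k] inner_add_left)
    moreover have "\<bar>p \<bullet> (D *v p)\<bar> \<le> b * (norm p)\<^sup>2"
    proof -
      have "\<bar>p \<bullet> (D *v p)\<bar> \<le> norm p * norm (D *v p)"
        by (rule Cauchy_Schwarz_ineq2)
      also have "\<dots> \<le> norm p * (b * norm p)"
        by (intro mult_left_mono b) auto
      finally show ?thesis by (simp add: power2_eq_square mult_ac)
    qed
    moreover have "e * b * (norm p)\<^sup>2 \<le> l * (norm p)\<^sup>2"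
      using e by (intro mult_right_mono) auto
    moreover have "e * \<bar>p \<bullet> (D *v p)\<bar> \<le> e * (b * (norm p)\<^sup>2)"
      using calculation(2) e by (intro mult_left_mono) auto
    moreover have "- (e * (p \<bullet> (D *v p))) \<le> e * \<bar>p \<bullet> (D *v p)\<bar>"
      using e(1) abs_ge_minus_self[of "e * (p \<bullet> (D *v p))"] by (simp add: abs_mult)
    ultimately have "- (v \<bullet> (X *v v)) \<le> e * (v \<bullet> (D *v v))"
      using p by (simp add: mult.assoc)
    then show ?thesis
      by (simp add: matrix_vector_mult_add_rdistrib inner_add_right flip: scaleR_matrix_vector_assoc)
  qed
  moreover have "X + e *\<^sub>R D \<in> Sym"
    using X Dsym subspace_Sym by (auto simp: psd_def intro: subspace_add subspace_scale)
  ultimately show thesis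
    using that e(1) by (simp add: psd_def)
qed

section \<open>Projection onto the face exposed by the dual matrix\<close>

lemma inner_diag: "diag d \<bullet> Y = (\<Sum>i\<in>UNIV. d i * Y $ i $ i)"
proof -
  have "(\<Sum>j\<in>UNIV. (if i = j then d i else 0) * Y $ i $ j) = d i * Y $ i $ i" for i
    by (subst sum.remove[of _ i]) auto
  then show ?thesis
    by (simp add: diag_def inner_vec_def)
qed

lemma Sym_block: "Y \<in> Sym \<Longrightarrow> block K Y \<in> Sym"
  by (auto simp: Sym_def block_def transpose_def vec_eq_iff)

text \<open>
  In the eigenbasis of \<open>Z\<close> let \<open>K\<close> be the set of indices with eigenvalue 0. Complementary slackness
  makes the diagonal of \<open>X\<close> vanish outside \<open>K\<close>, hence \<open>X\<close> is supported on \<open>K \<times> K\<close>; since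
  the ranks add up to the dimension, \<open>X\<close> is definite on this block, so restricting a matrix \<open>Y\<close> to
  the block is the orthogonal projection \<open>Q\<close> onto the face of \<open>X\<close>. Finally \<open>Z \<bullet> Y\<close> is at least
  the least positive eigenvalue of \<open>Z\<close> times the trace of \<open>Y\<close> outside \<open>K\<close>, and this trace
  bounds the squared distance of \<open>Y\<close> to \<open>Q Y\<close>. If \<open>K\<close> is a singleton, the face contains only one
  matrix of trace 1, and the same trace bounds the distance to \<open>X\<close> itself.
\<close>

proposition face_projection:
  fixes X Z :: "real^'n^'n"
  assumes X: "psd X" "trace X = 1" and Z: "psd Z" "0 < rank Z"
    and ZX: "Z \<bullet> X = 0" and ranks: "rank X + rank Z = CARD('n)"
  obtains Q where
    "\<And>Y. psd Y \<Longrightarrow> trace Y = 1 \<Longrightarrow> Q Y \<in> face_space X"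
    "\<And>Y. psd Y \<Longrightarrow> trace Y = 1 \<Longrightarrow>
      (norm (Y - X))\<^sup>2 = (norm (Y - Q Y))\<^sup>2 + (norm (Q Y - X))\<^sup>2"
    "\<And>Y. psd Y \<Longrightarrow> trace Y = 1 \<Longrightarrow>
      eigval (rank Z) Z * (norm (Y - Q Y))\<^sup>2 \<le> 2 * (Z \<bullet> Y)"
    "\<And>Y. psd Y \<Longrightarrow> trace Y = 1 \<Longrightarrow> rank Z = CARD('n) - 1 \<Longrightarrow>
      eigval (rank Z) Z * (norm (Y - X))\<^sup>2 \<le> 2 * (Z \<bullet> Y)"
proof -
  define l where "l = eigval (rank Z) Z"
  obtain U d where U: "orthogonal_matrix U" and d: "conjugate U Z = diag d"
    using Sym_diagonalizable Z(1) unfolding psd_def by blast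
  have l: "0 < l" and d0: "0 \<le> d i" and dl: "d i \<noteq> 0 \<Longrightarrow> l \<le> d i" for i
    using eigval_rank_least_positive[OF Z(1) U d Z(2)] by (auto simp: l_def)
  define K where "K = {i. d i = 0}"
  have cardK: "card (- K) = rank Z"
    using rank_conjugate[OF U, of Z] by (simp add: d rank_diag K_def Collect_neg_eq)
  define X' where "X' = conjugate U X"
  have X': "psd X'" "trace X' = 1" "X' \<in> Sym"
    using X psd_conjugate[of X U] by (simp_all add: X'_def trace_conjugate U psd_def)
  have ZU: "Z \<bullet> Y = (\<Sum>i\<in>UNIV. d i * conjugate U Y $ i $ i)" for Y
    using inner_conjugate[OF U, of Z Y] by (simp add: d inner_diag)

  have diag0: "X' $ i $ i = 0" if "i \<notin> K" for i
  proof -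
    have "(\<Sum>i\<in>UNIV. d i * X' $ i $ i) = 0"
      using ZU[of X] ZX by (simp add: X'_def)
    then have "d i * X' $ i $ i = 0"
      using psd_diagonal_nonneg[OF X'(1)] d0 by (subst (asm) sum_nonneg_eq_0_iff) auto
    then show ?thesis using that by (simp add: K_def)
  qed
  have X'0: "X' $ i $ j = 0" if "\<not> (i \<in> K \<and> j \<in> K)" for i j
    using psd_minor_nonneg[OF X'(1), of i j] that diag0[of i] diag0[of j] by auto
  then have bX: "block K X' = X'"
    by (auto simp: block_def vec_eq_iff)

  have range_X': "range ((*v) X') = {x. \<forall>i. i \<notin> K \<longrightarrow> x $ i = 0}" (is "_ = ?E")
  proof (rule subspace_dim_equal)
    show "subspace (range ((*v) X'))"
      by (intro linear_subspace_image) auto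
    show "subspace ?E"
      by (auto simp: subspace_def)
    show "range ((*v) X') \<subseteq> ?E"
      by (auto simp: matrix_vector_mult_def X'0 intro!: sum.neutral)
    have "card K + card (- K) = CARD('n)"
      using card_Un_disjoint[of K "- K"] by (simp add: Compl_partition)
    moreover have "dim ?E = card K"
      by (simp only: dim_substandard_cart flip: dim_vec_eq)
    moreover have "dim (range ((*v) X')) = rank X"
      using rank_conjugate[OF U, of X] by (simp add: X'_def rank_dim_range)
    ultimately show "dim ?E \<le> dim (range ((*v) X'))"
      using ranks cardK by simp
  qed
  \<comment> \<open>The range of the symmetric matrix \<open>X'\<close> is the full coordinate subspace, so its kernel is
    orthogonal to that subspace.\<close>
  have kerX': "w $ k = 0" if "X' *v w = 0" "k \<in> K" for w k
  proof -
    have "axis k 1 \<in> range ((*v) X')"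
      unfolding range_X' using that by (auto simp: axis_def)
    then obtain u where "axis k 1 = X' *v u" by blast
    then have "axis k 1 \<bullet> w = u \<bullet> (X' *v w)"
      by (simp add: Sym_inner[OF X'(3)])
    then show ?thesis using that by (simp add: inner_axis inner_commute[of "axis k 1"])
  qed

  define Q where "Q Y = conjugate (transpose U) (block K (conjugate U Y))" for Y
  have UQ: "conjugate U (Q Y) = block K (conjugate U Y)" for Y
    by (simp add: Q_def conjugate_conjugate_transpose U)
  have dist: "norm (Y - W) = norm (conjugate U Y - conjugate U W)" for Y W
    by (metis U conjugate_diff norm_conjugate)
  have Ut: "U *v (transpose U *v y) = y" for y
    using U by (simp add: matrix_vector_mul_assoc orthogonal_matrix_def del: transpose_matrix_vector)
  have Q_face: "Q Y \<in> face_space X" if "Y \<in> Sym" for Y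
  proof -
    have "Q Y *v v = 0" if "X *v v = 0" for v
    proof -
      define w where "w = transpose U *v v"
      have "X' *v w = 0"
        using conjugate_vector_mult[OF U, of X v] that
        by (simp add: X'_def w_def del: transpose_matrix_vector)
      then have "w $ k = 0" if "k \<in> K" for k
        using kerX' that by blast
      then have "block K (conjugate U Y) *v w = 0"
        by (auto simp: matrix_vector_mult_def block_def vec_eq_iff intro!: sum.neutral)
      then have "transpose U *v (Q Y *v v) = 0"
        using conjugate_vector_mult[OF U, of "Q Y" v] by (simp add: UQ w_def del: transpose_matrix_vector)
      then have "U *v (transpose U *v (Q Y *v v)) = 0"
        by simp
      then show ?thesis
        by (simp add: Ut del: transpose_matrix_vector)
    qed
    then show ?thesis
      using that by (simp add: face_space_def Q_def Sym_conjugate Sym_block)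
  qed
  have pyth: "(norm (Y - X))\<^sup>2 = (norm (Y - Q Y))\<^sup>2 + (norm (Q Y - X))\<^sup>2" for Y
    using block_pythagoras[OF bX, of "conjugate U Y"] by (simp add: dist[of Y X] dist[of Y "Q Y"] dist[of "Q Y" X] UQ X'_def)

  define t where "t Y = (\<Sum>i\<in>-K. conjugate U Y $ i $ i)" for Y
  have off: "(norm (Y - Q Y))\<^sup>2 \<le> 2 * t Y - (t Y)\<^sup>2" if "psd Y" "trace Y = 1" for Y
    using norm_off_block_le[of "conjugate U Y" K] that
    by (simp add: t_def dist[of Y "Q Y"] UQ psd_conjugate trace_conjugate U)
  have tZ: "l * t Y \<le> Z \<bullet> Y" if "psd Y" for Y
  proof -
    have nn: "0 \<le> conjugate U Y $ i $ i" for i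
      using psd_diagonal_nonneg psd_conjugate that by blast
    have "l * t Y \<le> (\<Sum>i\<in>-K. d i * conjugate U Y $ i $ i)"
      unfolding t_def sum_distrib_left
      using nn dl by (intro sum_mono mult_right_mono) (auto simp: K_def)
    also have "\<dots> \<le> Z \<bullet> Y"
      unfolding ZU using nn d0 by (intro sum_mono2) auto
    finally show ?thesis .
  qed
  show thesis
  proof (rule that)
    fix Y :: "real^'n^'n" assume Y: "psd Y" "trace Y = 1"
    show "Q Y \<in> face_space X"
      using Q_face Y by (simp add: psd_def)
    show "(norm (Y - X))\<^sup>2 = (norm (Y - Q Y))\<^sup>2 + (norm (Q Y - X))\<^sup>2"
      by (rule pyth)
    have "l * (norm (Y - Q Y))\<^sup>2 \<le> l * (2 * t Y)"
      using off[OF Y] l by (intro mult_left_mono) (auto intro: order_trans)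
    then show "eigval (rank Z) Z * (norm (Y - Q Y))\<^sup>2 \<le> 2 * (Z \<bullet> Y)"
      using tZ[OF Y(1)] by (simp add: l_def)
    assume "rank Z = CARD('n) - 1"
    moreover have "card K + card (- K) = CARD('n)"
      using card_Un_disjoint[of K "- K"] by (simp add: Compl_partition)
    ultimately have "card K = 1"
      using cardK Z(2) by linarith
    then obtain k where k: "K = {k}"
      using card_1_singletonE by blast
    have tr: "trace W = W $ k $ k + (\<Sum>i\<in>-K. W $ i $ i)" for W :: "real^'n^'n"
      unfolding trace_def by (subst sum.remove[of _ k]) (auto simp: k Compl_eq_Diff_UNIV)
    have "X' $ k $ k = 1"
      using X'(2) by (simp add: tr diag0)
    moreover have "conjugate U Y $ k $ k = 1 - t Y"
      using tr[of "conjugate U Y"] Y(2) by (simp add: t_def trace_conjugate U)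
    \<comment> \<open>The error inside the block is the single entry \<open>- t\<close>; its square cancels the negative
      quadratic term in the estimate for the entries outside the block.\<close>
    ultimately have "block K (conjugate U Y) - X' = axis k (axis k (- t Y))"
      using X'0 by (auto simp: block_def vec_eq_iff axis_def k)
    then have "(norm (Q Y - X))\<^sup>2 = (t Y)\<^sup>2"
      unfolding dist[of "Q Y" X] UQ X'_def[symmetric]
      by (simp add: power2_norm_eq_inner inner_axis_axis) (simp add: power2_eq_square)
    then have "(norm (Y - X))\<^sup>2 \<le> 2 * t Y"
      using off[OF Y] pyth[of Y] by linarith
    then have "l * (norm (Y - X))\<^sup>2 \<le> l * (2 * t Y)"
      using l by (intro mult_left_mono) auto
    then show "eigval (rank Z) Z * (norm (Y - X))\<^sup>2 \<le> 2 * (Z \<bullet> Y)"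
      using tZ[OF Y(1)] by (simp add: l_def)
  qed
qed

section \<open>Linear maps on the space of symmetric matrices\<close>

text \<open>
  Precomposing with the projection onto the symmetric part turns a map that is linear only on \<open>Sym\<close>
  into a linear map on the whole matrix space, to which boundedness and the lower bound for
  injective linear maps apply.
\<close>

lemma linear_on_Sym_extend:
  fixes B :: "real^'d^'d \<Rightarrow> 'b::real_vector"
  assumes B: "linear_on_Sym B"
  obtains B' where "linear B'" "\<And>X. X \<in> Sym \<Longrightarrow> B' X = B X"
proof
  let ?s = "\<lambda>X :: real^'d^'d. (1/2) *\<^sub>R (X + transpose X)"
  have s: "?s X \<in> Sym" for X
    by (simp add: Sym_def transpose_def vec_eq_iff)
  show "linear (\<lambda>X. B (?s X))"
  proof (rule linearI)
    fix X Y
    have "?s (X + Y) = ?s X + ?s Y"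
      by (simp add: transpose_def vec_eq_iff algebra_simps)
    then show "B (?s (X + Y)) = B (?s X) + B (?s Y)"
      using B s by (simp add: linear_on_Sym_def)
  next
    fix c X
    have "?s (c *\<^sub>R X) = c *\<^sub>R ?s X"
      by (simp add: transpose_def vec_eq_iff algebra_simps)
    then show "B (?s (c *\<^sub>R X)) = c *\<^sub>R B (?s X)"
      using B s unfolding linear_on_Sym_def by metis
  qed
  show "B (?s X) = B X" if "X \<in> Sym" for X
    using that by (simp add: Sym_def flip: scaleR_2)
qed

lemma linear_on_Sym_diff:
  assumes "linear_on_Sym B" "X \<in> Sym" "Y \<in> Sym"
  shows "B (X - Y) = B X - B Y"
proof -
  obtain B' where "linear B'" "\<And>X. X \<in> Sym \<Longrightarrow> B' X = B X"
    using linear_on_Sym_extend[OF assms(1)] by blast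
  then show ?thesis
    using assms linear_diff subspace_diff[OF subspace_Sym] by metis
qed

lemma linear_on_Sym_0: "linear_on_Sym B \<Longrightarrow> B 0 = 0"
  using linear_on_Sym_diff[of B 0 0] subspace_0[OF subspace_Sym] by simp

lemma linear_on_Sym_normalize:
  assumes "linear_on_Sym B" "S \<in> Sym" "S \<noteq> 0"
  shows "S /\<^sub>R norm S \<in> {X \<in> Sym. norm X = 1}" "norm (B (S /\<^sub>R norm S)) * norm S = norm (B S)"
  using assms subspace_scale[OF subspace_Sym] by (auto simp: linear_on_Sym_def)

lemma sigma_max_bound:
  fixes B :: "real^'d^'d \<Rightarrow> real^'l"
  assumes B: "linear_on_Sym B" and S: "S \<in> Sym"
  shows "norm (B S) \<le> sigma_max B * norm S"
proof (cases "S = 0")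
  case True
  then show ?thesis by (simp add: linear_on_Sym_0[OF B])
next
  case False
  obtain B' where B': "linear B'" "\<And>X. X \<in> Sym \<Longrightarrow> B' X = B X"
    using linear_on_Sym_extend[OF B] by blast
  have "norm (B X) \<le> onorm B'" if "X \<in> {X \<in> Sym. norm X = 1}" for X
    using onorm[OF linear_conv_bounded_linear[THEN iffD1, OF B'(1)], of X] that B'(2)[of X] by simp
  then have "bdd_above ((\<lambda>X. norm (B X)) ` {X \<in> Sym. norm X = 1})"
    by (auto simp: bdd_above_def)
  then have "norm (B (S /\<^sub>R norm S)) \<le> sigma_max B"
    unfolding sigma_max_def by (intro cSUP_upper linear_on_Sym_normalize[OF B S False])
  then show ?thesis
    using linear_on_Sym_normalize(2)[OF B S False] by (metis mult_right_mono norm_ge_zero)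
qed

lemma linear_on_Sym_injective_bound:
  fixes B :: "real^'d^'d \<Rightarrow> real^'l"
  assumes B: "linear_on_Sym B" and F: "subspace F" "F \<subseteq> Sym"
    and inj: "\<And>X. X \<in> F \<Longrightarrow> B X = 0 \<Longrightarrow> X = 0"
  obtains e where "0 < e" "\<And>X. X \<in> F \<Longrightarrow> e * norm X \<le> norm (B X)"
proof -
  obtain B' where B': "linear B'" "\<And>X. X \<in> Sym \<Longrightarrow> B' X = B X"
    using linear_on_Sym_extend[OF B] by blast
  have "\<forall>X\<in>F. B' X = 0 \<longrightarrow> X = 0"
    using F(2) inj B'(2) by (metis subsetD)
  then obtain e where "0 < e" "\<forall>X\<in>F. norm (B' X) \<ge> e * norm X"
    using injective_imp_isometric[OF closed_subspace[OF F(1)] F(1), of B'] B'(1)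
    by (auto simp: linear_conv_bounded_linear)
  then show thesis
    using that F(2) B'(2) by (metis subsetD)
qed

lemma sigma_min_bound:
  assumes B: "linear_on_Sym B" and S: "S \<in> Sym"
  shows "sigma_min B * norm S \<le> norm (B S)"
proof (cases "S = 0")
  case False
  have "bdd_below ((\<lambda>X. norm (B X)) ` {X \<in> Sym. norm X = 1})"
    by (auto simp: bdd_below_def intro: exI[of _ 0])
  then have "sigma_min B \<le> norm (B (S /\<^sub>R norm S))"
    unfolding sigma_min_def by (intro cINF_lower linear_on_Sym_normalize[OF B S False])
  then show ?thesis
    using linear_on_Sym_normalize(2)[OF B S False] by (metis mult_right_mono norm_ge_zero)
qed simp

lemma mat_1_Sym: "mat 1 \<in> Sym"
  by (simp add: Sym_def)

text \<open>
  Positivity of the infimum is where finite dimension enters: an injective linear map on \<open>Sym\<close> is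
  bounded below.
\<close>

lemma sigma_min_pos:
  fixes B :: "real^'d^'d \<Rightarrow> real^'l"
  assumes B: "linear_on_Sym B" and inj: "\<And>X. X \<in> Sym \<Longrightarrow> B X = 0 \<Longrightarrow> X = 0"
  shows "0 < sigma_min B"
proof -
  obtain e where e: "0 < e" "\<And>X. X \<in> Sym \<Longrightarrow> e * norm X \<le> norm (B X)"
    using linear_on_Sym_injective_bound[OF B subspace_Sym order_refl inj] by blast
  have "(mat 1 :: real^'d^'d) \<noteq> 0"
    by (simp add: vec_eq_iff mat_def)
  then have "{X \<in> Sym. norm X = 1} \<noteq> ({} :: (real^'d^'d) set)"
    using linear_on_Sym_normalize(1)[OF B mat_1_Sym] by blast
  then have "e \<le> sigma_min B"
    unfolding sigma_min_def
    using e(2) by (intro cINF_greatest) (auto, metis mult.right_neutral)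
  then show ?thesis
    using e(1) by simp
qed

lemma trace_scaleR: "trace (c *\<^sub>R X) = c * trace X" for X :: "real^'n^'n"
  by (simp add: trace_def sum_distrib_left)

lemma linear_on_Sym_with_trace:
  assumes "linear_on_Sym A"
  shows "linear_on_Sym (with_trace A)"
  using assms
  by (auto simp: linear_on_Sym_def with_trace_def vec_eq_iff trace_add trace_scaleR split: option.split)

lemma norm_with_trace: "(norm (with_trace A X))\<^sup>2 = (trace X)\<^sup>2 + (norm (A X))\<^sup>2"
  by (simp add: power2_norm_eq_inner inner_vec_def with_trace_def UNIV_option_conv sum.reindex)
    (simp add: power2_eq_square)

lemma Sym_congruence: "S \<in> Sym \<Longrightarrow> V ** S ** transpose V \<in> Sym"
  by (simp add: Sym_def matrix_transpose_mul matrix_mul_assoc)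

lemma linear_on_Sym_compress:
  fixes V :: "real^'r^'d"
  assumes "linear_on_Sym B"
  shows "linear_on_Sym (compress B V)"
proof -
  have "V ** (S + T) ** transpose V = V ** S ** transpose V + V ** T ** transpose V"
    for S T :: "real^'r^'r"
    by (simp add: matrix_add_ldistrib)
      (simp add: matrix_matrix_mult_def vec_eq_iff sum.distrib distrib_right)
  moreover have "V ** (c *\<^sub>R S) ** transpose V = c *\<^sub>R (V ** S ** transpose V)" for c and S :: "real^'r^'r"
    by (simp add: matrix_scalar_ac flip: scalar_matrix_assoc)
  ultimately show ?thesis
    using assms by (simp add: linear_on_Sym_def compress_def Sym_congruence)
qed

section \<open>Parametrizing the face\<close>

text \<open>
  \<open>S \<mapsto> V S V\<^sup>T\<close> is an isometry from the symmetric matrices of size \<open>rank X\<close> onto the face space.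
  It identifies the smallest singular value of the compressed map with that of the restriction to
  the face. The reason is that \<open>V V\<^sup>T\<close> projects onto the range of \<open>X\<close>, so that
  \<open>D = V (V\<^sup>T D V) V\<^sup>T\<close> for every \<open>D\<close> in the face space.
\<close>

lemma face_space_parametrization:
  fixes V :: "real^'r^'n"
  assumes V: "orthonormal_range_basis V X" and X: "X \<in> Sym"
  shows "S \<in> Sym \<Longrightarrow> V ** S ** transpose V \<in> face_space X"
    and "D \<in> face_space X \<Longrightarrow> \<exists>S\<in>Sym. norm S = norm D \<and> V ** S ** transpose V = D"
proof -
  have VV: "transpose V ** V = mat 1" and span: "span (columns V) = range ((*v) X)"
    using V by (auto simp: orthonormal_range_basis_def)
  have ker: "transpose V *v v = 0 \<longleftrightarrow> X *v v = 0" for v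
  proof
    assume X0: "X *v v = 0"
    have "y \<bullet> (transpose V *v v) = 0" for y
    proof -
      have "V *v y \<in> range ((*v) X)"
        using matrix_vector_mult_in_columnspace[of V y] span by simp
      then obtain u where "V *v y = X *v u" by blast
      then have "(V *v y) \<bullet> v = u \<bullet> (X *v v)"
        by (simp add: Sym_inner[OF X])
      then show ?thesis
        using X0 by (simp add: inner_matrix_vector_mult del: transpose_matrix_vector)
    qed
    then show "transpose V *v v = 0"
      using inner_eq_zero_iff by blast
  next
    assume V0: "transpose V *v v = 0"
    have "orthogonal v x" if x: "x \<in> columns V" for x
    proof -
      obtain i where "x = column i V"
        using x unfolding columns_def by blast
      then have "x \<bullet> v = (transpose V *v v) $ i"
        by (simp add: column_def inner_vec_def matrix_vector_mult_def transpose_def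
            del: transpose_matrix_vector)
      then show ?thesis
        using V0 by (simp add: orthogonal_def inner_commute del: transpose_matrix_vector)
    qed
    then have "orthogonal v (X *v u)" for u
      using orthogonal_to_span[of "X *v u" "columns V" v] span by auto
    then have "(X *v v) \<bullet> (X *v v) = 0"
      using Sym_inner[OF X, of v "X *v v"] by (simp add: orthogonal_def)
    then show "X *v v = 0" by simp
  qed
  show "V ** S ** transpose V \<in> face_space X" if S: "S \<in> Sym"
  proof -
    have "(V ** S ** transpose V) *v v = 0" if "X *v v = 0" for v
    proof -
      have "transpose V *v v = 0"
        using that ker by blast
      then show ?thesis
        by (simp del: transpose_matrix_vector flip: matrix_vector_mul_assoc)
    qed
    then show ?thesis
      by (simp add: face_space_def Sym_congruence S)
  qed
  assume D: "D \<in> face_space X"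
  then have sym: "transpose D = D" and D0: "\<And>v. X *v v = 0 \<Longrightarrow> D *v v = 0"
    by (auto simp: face_space_def Sym_def)
  define S where "S = transpose V ** D ** V"
  have S: "S \<in> Sym"
    by (simp add: S_def Sym_def matrix_transpose_mul matrix_mul_assoc sym)
  have DVV: "D ** (V ** transpose V) = D"
  proof -
    have "D *v (v - V *v (transpose V *v v)) = 0" for v
    proof -
      have "transpose V *v (v - V *v (transpose V *v v)) = 0"
        by (simp add: matrix_vector_mult_diff_distrib matrix_vector_mul_assoc[of "transpose V" V] VV
            del: transpose_matrix_vector)
      then show ?thesis using ker D0 by blast
    qed
    then show ?thesis
      by (simp add: matrix_eq matrix_vector_mult_diff_distrib del: transpose_matrix_vector
          flip: matrix_vector_mul_assoc)
  qed
  then have VVD: "V ** (transpose V ** D) = D"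
    by (metis matrix_mul_assoc matrix_transpose_mul sym transpose_transpose)
  have VSV: "V ** S ** transpose V = D"
    by (metis DVV VVD S_def matrix_mul_assoc)
  have "transpose S ** S = transpose V ** (D ** (V ** transpose V)) ** D ** V"
    by (simp add: S_def matrix_transpose_mul sym matrix_mul_assoc)
  then have "trace (transpose S ** S) = trace (transpose V ** (D ** D ** V))"
    unfolding DVV by (simp add: matrix_mul_assoc)
  also have "\<dots> = trace (D ** D ** V ** transpose V)"
    by (rule trace_mul_sym)
  also have "\<dots> = trace (transpose D ** D)"
    by (metis DVV matrix_mul_assoc sym)
  finally have "norm S = norm D"
    by (simp add: norm_eq_sqrt_trace)
  then show "\<exists>S\<in>Sym. norm S = norm D \<and> V ** S ** transpose V = D"
    using S VSV by blast
qed

section \<open>Growth of the objective at a KKT point\<close>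

text \<open>
  Dividing the chord inequality by \<open>t\<close> and letting \<open>t \<rightarrow> 0\<close> yields the gradient inequality. The
  segment from \<open>X\<close> to \<open>Y\<close> stays in \<open>Sym\<close>, the set within which the gradient is taken.
\<close>

lemma gradient_le_of_chord_bound:
  fixes f :: "real^'n^'n \<Rightarrow> real"
  assumes G: "has_Sym_gradient f X G" and XY: "X \<in> Sym" "Y \<in> Sym"
    and chord: "\<And>t. 0 < t \<Longrightarrow> t < 1 \<Longrightarrow> f (t *\<^sub>R Y + (1 - t) *\<^sub>R X) \<le> t * f Y + (1 - t) * f X - a * t * (1 - t)"
  shows "G \<bullet> (Y - X) + a \<le> f Y - f X"
proof -
  define p where "p t = X + t *\<^sub>R (Y - X)" for t :: real
  have "p ` UNIV \<subseteq> Sym"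
    using XY subspace_Sym by (auto simp: p_def intro!: subspace_add subspace_scale subspace_diff)
  moreover have "(f has_derivative (\<lambda>H. G \<bullet> H)) (at (p 0) within Sym)"
    using G by (simp add: has_Sym_gradient_def p_def)
  ultimately have f: "(f has_derivative (\<lambda>H. G \<bullet> H)) (at (p 0) within p ` UNIV)"
    by (rule has_derivative_subset[rotated])
  have "(p has_derivative (\<lambda>t. t *\<^sub>R (Y - X))) (at 0 within UNIV)"
    unfolding p_def by (auto intro!: derivative_eq_intros)
  then have "((\<lambda>t. f (p t)) has_derivative (\<lambda>t. G \<bullet> (t *\<^sub>R (Y - X)))) (at 0)"
    using f by (rule has_derivative_in_compose)
  then have "((\<lambda>t. f (p t)) has_real_derivative G \<bullet> (Y - X)) (at 0)"
    by (simp add: has_field_derivative_def mult_commute_abs)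
  then have "((\<lambda>t. (f (p t) - f X) / t) \<longlongrightarrow> G \<bullet> (Y - X)) (at_right 0)"
    by (auto simp: has_field_derivative_iff p_def intro: tendsto_mono[OF at_le])
  moreover have "((\<lambda>t. f Y - f X - a * (1 - t)) \<longlongrightarrow> f Y - f X - a * (1 - 0)) (at_right 0)"
    by (intro tendsto_intros)
  moreover have "\<forall>\<^sub>F t in at_right 0. (f (p t) - f X) / t \<le> f Y - f X - a * (1 - t)"
  proof (rule eventually_at_right_less[of 0, THEN eventually_rev_mp])
    show "\<forall>\<^sub>F t::real in at_right 0. 0 < t \<longrightarrow> (f (p t) - f X) / t \<le> f Y - f X - a * (1 - t)"
    proof (rule eventually_at_rightI[of 0 1])
      fix t :: real assume "t \<in> {0<..<1}"
      then have t: "0 < t" "t < 1" by auto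
      have pt: "t *\<^sub>R Y + (1 - t) *\<^sub>R X = p t"
        by (simp add: p_def algebra_simps)
      have "f (p t) - f X \<le> (f Y - f X - a * (1 - t)) * t"
        using chord[OF t] unfolding pt by (simp add: algebra_simps)
      then show "0 < t \<longrightarrow> (f (p t) - f X) / t \<le> f Y - f X - a * (1 - t)"
        by (simp add: pos_divide_le_eq)
    qed simp
  qed
  ultimately have "G \<bullet> (Y - X) \<le> f Y - f X - a * (1 - 0)"
    by (intro tendsto_le[OF trivial_limit_at_right_real])
  then show ?thesis by simp
qed

lemma strongly_convex_0:
  assumes "convex_on UNIV g"
  shows "strongly_convex 0 g"
  using assms by (auto simp: strongly_convex_def convex_on_def)

lemma spectrahedronD: "X \<in> spectrahedron \<Longrightarrow> psd X \<and> trace X = 1 \<and> X \<in> Sym"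
  by (simp add: spectrahedron_def psd_def)

lemma inner_mat_1: "mat 1 \<bullet> X = trace X" for X :: "real^'n^'n"
  by (simp add: inner_eq_trace)

text \<open>
  The gradient at a KKT point is \<open>Z + s I\<close>. Paired with \<open>Y - X\<close>, the multiple of the identity drops
  out because both traces are 1, and \<open>Z \<bullet> X = 0\<close>.
\<close>

proposition KKT_growth:
  fixes g :: "real^'m \<Rightarrow> real" and A :: "real^'n^'n \<Rightarrow> real^'m"
  assumes g: "strongly_convex \<alpha> g" and A: "linear_on_Sym A"
    and kkt: "KKT (objective g A C) X Z s" and Y: "Y \<in> spectrahedron"
  shows "Z \<bullet> Y + \<alpha> / 2 * (norm (A Y - A X))\<^sup>2 \<le> objective g A C Y - objective g A C X"
proof -
  obtain G where G: "has_Sym_gradient (objective g A C) X G" "G - Z - s *\<^sub>R mat 1 = 0"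
    and X: "Z \<bullet> X = 0" "trace X = 1" "X \<in> Sym"
    using kkt by (auto simp: KKT_def psd_def)
  have Y': "trace Y = 1" "Y \<in> Sym"
    using spectrahedronD[OF Y] by auto
  have "G \<bullet> (Y - X) + \<alpha> / 2 * (norm (A Y - A X))\<^sup>2 \<le> objective g A C Y - objective g A C X"
  proof (rule gradient_le_of_chord_bound[OF G(1) X(3) Y'(2)])
    fix t :: real assume t: "0 < t" "t < 1"
    have At: "A (t *\<^sub>R Y + (1 - t) *\<^sub>R X) = t *\<^sub>R A Y + (1 - t) *\<^sub>R A X"
      using A X(3) Y'(2) subspace_scale[OF subspace_Sym] unfolding linear_on_Sym_def by metis
    have "g (t *\<^sub>R A Y + (1 - t) *\<^sub>R A X)
        \<le> t * g (A Y) + (1 - t) * g (A X) - \<alpha> / 2 * t * (1 - t) * (norm (A Y - A X))\<^sup>2"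
      using g t by (simp add: strongly_convex_def)
    then show "objective g A C (t *\<^sub>R Y + (1 - t) *\<^sub>R X)
        \<le> t * objective g A C Y + (1 - t) * objective g A C X
          - \<alpha> / 2 * (norm (A Y - A X))\<^sup>2 * t * (1 - t)"
      unfolding objective_def At by (simp add: inner_add_right algebra_simps)
  qed
  moreover have "G = Z + s *\<^sub>R mat 1"
    using G(2) by (simp add: algebra_simps)
  then have "G \<bullet> (Y - X) = Z \<bullet> Y"
    by (simp add: inner_add_left inner_diff_right inner_mat_1 X Y')
  ultimately show ?thesis by simp
qed

text \<open>
  Split \<open>Y - X\<close> orthogonally into \<open>Y - Q Y\<close> and \<open>Q Y - X\<close>. The first part is controlled by
  \<open>Z \<bullet> Y\<close>. The second lies in the face space, where the augmented map is bounded below, so it is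
  controlled by the change \<open>A Y - A X\<close>, which strong convexity pays for, and by the first part. The
  trace component of the augmented map vanishes on \<open>Y - X\<close>.
\<close>

proposition quadratic_growth_if_bounded_on_face:
  fixes g :: "real^'m \<Rightarrow> real" and A :: "real^'n^'n \<Rightarrow> real^'m"
  assumes g: "strongly_convex \<alpha> g" "0 < \<alpha>" and A: "linear_on_Sym A"
    and kkt: "KKT (objective g A C) X Z s" and ranks: "rank X + rank Z = CARD('n)" "0 < rank Z"
    and lower: "0 < l" "\<And>D. D \<in> face_space X \<Longrightarrow> l * norm D \<le> norm (with_trace A D)"
    and upper: "\<And>D. D \<in> Sym \<Longrightarrow> norm (with_trace A D) \<le> u * norm D"
  shows "quadratic_growth (objective g A C) X
    (min (eigval (rank Z) Z / (4 + 8 * (u\<^sup>2 / l\<^sup>2))) (\<alpha> * l\<^sup>2 / 8))"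
proof -
  have X: "psd X" "trace X = 1" "X \<in> Sym" and Z: "psd Z" "Z \<bullet> X = 0"
    using kkt by (auto simp: KKT_def psd_def)
  define e where "e = eigval (rank Z) Z"
  obtain U d where "orthogonal_matrix U" "conjugate U Z = diag d"
    using Sym_diagonalizable Z(1) unfolding psd_def by blast
  then have e: "0 < e"
    unfolding e_def using eigval_rank_least_positive(2)[OF Z(1) _ _ ranks(2)] by blast
  define \<kappa> where "\<kappa> = u\<^sup>2 / l\<^sup>2"
  define \<gamma> where "\<gamma> = min (e / (4 + 8 * \<kappa>)) (\<alpha> * l\<^sup>2 / 8)"
  have \<kappa>: "0 \<le> \<kappa>" by (simp add: \<kappa>_def)
  then have "0 < 4 + 8 * \<kappa>" by simp
  moreover have "\<gamma> \<le> e / (4 + 8 * \<kappa>)"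
    by (simp add: \<gamma>_def)
  ultimately have "\<gamma> * (4 + 8 * \<kappa>) \<le> e"
    by (simp add: pos_le_divide_eq)
  moreover have "\<gamma> * 8 \<le> \<alpha> * l\<^sup>2"
    using min.cobounded2[of "e / (4 + 8 * \<kappa>)" "\<alpha> * l\<^sup>2 / 8"] by (simp add: \<gamma>_def)
  moreover have "0 < \<gamma>"
    using \<open>0 < 4 + 8 * \<kappa>\<close> e g(2) lower(1) by (simp add: \<gamma>_def)
  ultimately have \<gamma>: "0 < \<gamma>" "\<gamma> * (4 + 8 * \<kappa>) \<le> e" "\<gamma> * 8 \<le> \<alpha> * l\<^sup>2"
    by blast+
  obtain Q where Q: "\<And>Y. psd Y \<Longrightarrow> trace Y = 1 \<Longrightarrow> Q Y \<in> face_space X"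
    "\<And>Y. psd Y \<Longrightarrow> trace Y = 1 \<Longrightarrow>
      (norm (Y - X))\<^sup>2 = (norm (Y - Q Y))\<^sup>2 + (norm (Q Y - X))\<^sup>2"
    "\<And>Y. psd Y \<Longrightarrow> trace Y = 1 \<Longrightarrow> e * (norm (Y - Q Y))\<^sup>2 \<le> 2 * (Z \<bullet> Y)"
    using face_projection[OF X(1,2) Z(1) ranks(2) Z(2) ranks(1)] unfolding e_def by metis
  have B: "linear_on_Sym (with_trace A)"
    using A by (rule linear_on_Sym_with_trace)
  have "\<gamma> * (norm (Y - X))\<^sup>2 \<le> objective g A C Y - objective g A C X" if "Y \<in> spectrahedron" for Y
  proof -
    have Y: "psd Y" "trace Y = 1" "Y \<in> Sym"
      using spectrahedronD[OF that] by auto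
    \<comment> \<open>\<open>a\<close> and \<open>c\<close> are the squared lengths of the parts off and along the face, \<open>b\<close> is the term
      supplied by strong convexity.\<close>
    define a b c where "a = (norm (Y - Q Y))\<^sup>2" and "b = (norm (A Y - A X))\<^sup>2"
      and "c = (norm (Q Y - X))\<^sup>2"
    have QY: "Q Y \<in> Sym" "Q Y - X \<in> face_space X" "Y - Q Y \<in> Sym" "Y - X \<in> Sym"
      using Q(1)[OF Y(1,2)] X(3) Y(3)
      by (auto simp: face_space_def matrix_vector_mult_diff_rdistrib intro!: subspace_diff[OF subspace_Sym])
    have b: "(norm (with_trace A (Y - X)))\<^sup>2 = b"
      by (simp add: norm_with_trace trace_sub Y X linear_on_Sym_diff[OF A] b_def)
    have "Q Y - X = (Y - X) - (Y - Q Y)" by simp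
    then have "with_trace A (Q Y - X) = with_trace A (Y - X) - with_trace A (Y - Q Y)"
      using linear_on_Sym_diff[OF B QY(4,3)] by simp
    then have "l * norm (Q Y - X) \<le> norm (with_trace A (Y - X)) + norm (with_trace A (Y - Q Y))"
      using lower(2)[OF QY(2)] norm_triangle_ineq4 order_trans by metis
    also have "\<dots> \<le> norm (with_trace A (Y - X)) + u * norm (Y - Q Y)"
      using upper[OF QY(3)] by simp
    finally have "(l * norm (Q Y - X))\<^sup>2 \<le> (norm (with_trace A (Y - X)) + u * norm (Y - Q Y))\<^sup>2"
      using lower(1) by (intro power_mono) auto
    also have "\<dots> \<le> 2 * (norm (with_trace A (Y - X)))\<^sup>2 + 2 * (u * norm (Y - Q Y))\<^sup>2"
      using sum_squares_bound[of "norm (with_trace A (Y - X))" "u * norm (Y - Q Y)"]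
      by (simp add: power2_sum)
    finally have "l\<^sup>2 * c \<le> 2 * b + 2 * u\<^sup>2 * a"
      by (simp add: b a_def c_def power_mult_distrib)
    then have c: "c \<le> 2 * b / l\<^sup>2 + 2 * \<kappa> * a"
      using lower(1) by (simp add: \<kappa>_def field_simps)
    have "\<gamma> * (norm (Y - X))\<^sup>2 = \<gamma> * (a + c)"
      using Q(2)[OF Y(1,2)] by (simp add: a_def c_def)
    also have "\<dots> \<le> \<gamma> * (a + (2 * b / l\<^sup>2 + 2 * \<kappa> * a))"
      using c \<gamma>(1) by (intro mult_left_mono) auto
    also have "\<dots> = \<gamma> * (4 + 8 * \<kappa>) * a / 4 + \<gamma> * 8 * b / (4 * l\<^sup>2)"
      using lower(1) by (simp add: field_simps)
    also have "\<dots> \<le> e * a / 4 + \<alpha> * l\<^sup>2 * b / (4 * l\<^sup>2)"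
      using \<gamma>(2,3) lower(1)
      by (intro add_mono divide_right_mono mult_right_mono) (auto simp: a_def b_def)
    also have "\<dots> = e * a / 4 + \<alpha> * b / 4"
      using lower(1) by simp
    also have "\<dots> \<le> e * a / 2 + \<alpha> / 2 * b"
      using e g(2) by (intro add_mono) (auto simp: a_def b_def divide_simps)
    also have "\<dots> \<le> Z \<bullet> Y + \<alpha> / 2 * b"
      using Q(3)[OF Y(1,2)] by (simp add: a_def)
    also have "\<dots> \<le> objective g A C Y - objective g A C X"
      using KKT_growth[OF g(1) A kkt that] by (simp add: b_def)
    finally show ?thesis .
  qed
  then show ?thesis
    using \<gamma>(1) by (simp add: quadratic_growth_def \<gamma>_def e_def \<kappa>_def)
qed

proposition quadratic_growth_if_rank_one:
  fixes g :: "real^'m \<Rightarrow> real" and A :: "real^'n^'n \<Rightarrow> real^'m"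
  assumes g: "convex_on UNIV g" and A: "linear_on_Sym A"
    and kkt: "KKT (objective g A C) X Z s" and ranks: "rank X + rank Z = CARD('n)" "0 < rank Z"
    and rank: "rank Z = CARD('n) - 1"
  shows "quadratic_growth (objective g A C) X (eigval (rank Z) Z / 2)"
proof -
  have X: "psd X" "trace X = 1" and Z: "psd Z" "Z \<bullet> X = 0"
    using kkt by (auto simp: KKT_def)
  obtain U d where "orthogonal_matrix U" "conjugate U Z = diag d"
    using Sym_diagonalizable Z(1) unfolding psd_def by blast
  then have e: "0 < eigval (rank Z) Z"
    using eigval_rank_least_positive(2)[OF Z(1) _ _ ranks(2)] by blast
  obtain Q :: "real^'n^'n \<Rightarrow> real^'n^'n" where
    Q: "\<And>Y. psd Y \<Longrightarrow> trace Y = 1 \<Longrightarrow> rank Z = CARD('n) - 1 \<Longrightarrow>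
      eigval (rank Z) Z * (norm (Y - X))\<^sup>2 \<le> 2 * (Z \<bullet> Y)"
    using face_projection[OF X Z(1) ranks(2) Z(2) ranks(1)] by blast
  have "eigval (rank Z) Z / 2 * (norm (Y - X))\<^sup>2 \<le> objective g A C Y - objective g A C X"
    if "Y \<in> spectrahedron" for Y
    using Q[of Y] rank spectrahedronD[OF that] KKT_growth[OF strongly_convex_0[OF g] A kkt that]
    by simp
  then show ?thesis
    using e by (simp add: quadratic_growth_def)
qed

lemma quadratic_growth_unique:
  assumes "quadratic_growth f X \<gamma>" "optimal_solution f X" "optimal_solution f Y"
  shows "Y = X"
proof -
  have "\<gamma> * (norm (Y - X))\<^sup>2 \<le> 0" "0 < \<gamma>"
    using assms unfolding quadratic_growth_def optimal_solution_def by fastforce+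
  then show ?thesis
    by (simp add: mult_le_0_iff)
qed

section \<open>Uniqueness of the optimum\<close>

text \<open>
  If the augmented map kills a direction \<open>D\<close> of the face, then \<open>X\<close> can be moved a little both ways
  along \<open>D\<close> without leaving the feasible set, and the objective is affine along this segment.
  Optimality of \<open>X\<close> makes it constant there, so the whole segment is optimal.
\<close>

lemma unique_optimum_injective_on_face:
  fixes A :: "real^'n^'n \<Rightarrow> real^'m"
  assumes A: "linear_on_Sym A" and opt: "optimal_solution (objective g A C) X"
    and unique: "\<And>Y. optimal_solution (objective g A C) Y \<Longrightarrow> Y = X"
    and D: "D \<in> face_space X" "with_trace A D = 0"
  shows "D = 0"
proof -
  have X: "psd X" "trace X = 1" "X \<in> Sym"
    using opt spectrahedronD by (auto simp: optimal_solution_def)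
  have "X \<noteq> 0"
    using X(2) by (auto simp: trace_def)
  then have rank: "0 < rank X"
    by (simp add: rank_eq_0[symmetric])
  have "trace D = 0" "A D = 0"
    using D(2) norm_with_trace[of A D] by (simp_all add: sum_power2_eq_zero_iff)
  have Dsym: "D \<in> Sym"
    using D(1) by (simp add: face_space_def)
  have obj: "objective g A C (X + e *\<^sub>R D) = objective g A C X + e * (C \<bullet> D)" for e
  proof -
    have "A (X + e *\<^sub>R D) = A X"
      using A X(3) Dsym \<open>A D = 0\<close> subspace_scale[OF subspace_Sym, of D e]
      unfolding linear_on_Sym_def by (metis add.right_neutral scaleR_zero_right)
    then show ?thesis
      by (simp add: objective_def inner_add_right)
  qed
  have feasible: "X + e *\<^sub>R D \<in> spectrahedron" if "psd (X + e *\<^sub>R D)" for e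
    using that X(2) \<open>trace D = 0\<close> by (simp add: spectrahedron_def trace_add trace_scaleR)
  obtain e where e: "0 < e" "psd (X + e *\<^sub>R D)"
    using psd_perturb_in_face[OF X(1) rank D(1)] by blast
  obtain e' where e': "0 < e'" "psd (X + (- e') *\<^sub>R D)"
    using psd_perturb_in_face[OF X(1) rank subspace_neg[OF subspace_face_space D(1)]] by auto
  have "0 \<le> e * (C \<bullet> D)"
    using opt feasible[OF e(2)] obj[of e] by (auto simp: optimal_solution_def)
  moreover have "0 \<le> - e' * (C \<bullet> D)"
    using opt feasible[OF e'(2)] obj[of "- e'"] by (auto simp: optimal_solution_def)
  ultimately have "C \<bullet> D = 0"
    using e(1) e'(1) by (simp add: zero_le_mult_iff mult_le_0_iff)
  then have "optimal_solution (objective g A C) (X + e *\<^sub>R D)"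
    using opt feasible[OF e(2)] obj[of e] by (simp add: optimal_solution_def)
  then show ?thesis
    using unique e(1) by force
qed

section \<open>Quadratic growth over the spectrahedron\<close>

theorem theorem6:
  fixes g :: "real^'m \<Rightarrow> real" and grad_g :: "real^'m \<Rightarrow> real^'m" and L \<alpha> :: real
    and A :: "real^'n^'n \<Rightarrow> real^'m" and C :: "real^'n^'n"
    and f :: "real^'n^'n \<Rightarrow> real"
    and Xs Zs :: "real^'n^'n" and ss :: real
    and V :: "real^'r^'n"
  assumes g_convex: "convex_on UNIV g"
    and g_grad: "\<And>y. GDERIV g y :> grad_g y"
    and g_smooth: "L-lipschitz_on UNIV grad_g"
    and A_linear: "linear_on_Sym A"
    and C_sym: "C \<in> Sym"
    and f_eq: "f = objective g A C"
    and Xs_opt: "optimal_solution f Xs"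
    and kkt: "KKT f Xs Zs ss"
    and sc: "strict_complementarity Xs Zs"
    and rank_less: "rank Xs < CARD('n)"
  defines "case_i \<equiv> \<alpha> > 0 \<and> strongly_convex \<alpha> g \<and> (\<forall>X. optimal_solution f X \<longrightarrow> X = Xs)"
    and "case_ii \<equiv> rank Zs = CARD('n) - 1"
  shows "(case_i \<or> case_ii \<longrightarrow> (\<exists>\<gamma>. quadratic_growth f Xs \<gamma>)) \<and>
    (case_i \<and> orthonormal_range_basis V Xs \<longrightarrow>
       quadratic_growth f Xs
         (min (eigval (CARD('n) - rank Xs) Zs /
                 (4 + 8 * ((sigma_max (with_trace A))\<^sup>2 /
                           (sigma_min (compress (with_trace A) V))\<^sup>2)))
              (\<alpha> * (sigma_min (compress (with_trace A) V))\<^sup>2 / 8))) \<and>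
    (case_ii \<longrightarrow>
       quadratic_growth f Xs (eigval (CARD('n) - rank Xs) Zs / 2) \<and>
       (\<forall>X. optimal_solution f X \<longrightarrow> X = Xs))"
proof -
  have ranks: "rank Xs + rank Zs = CARD('n)"
    using sc by (simp add: strict_complementarity_def)
  then have rank: "0 < rank Zs" "CARD('n) - rank Xs = rank Zs"
    using rank_less by auto
  have Xs: "Xs \<in> Sym"
    using kkt by (simp add: KKT_def psd_def)
  have B: "linear_on_Sym (with_trace A)"
    using A_linear by (rule linear_on_Sym_with_trace)
  have inj: "D = 0" if case_i "D \<in> face_space Xs" "with_trace A D = 0" for D
    using unique_optimum_injective_on_face[OF A_linear Xs_opt[unfolded f_eq] _ that(2,3)] that(1)
    by (auto simp: case_i_def f_eq)
  note growth_i = quadratic_growth_if_bounded_on_face[OF _ _ A_linear kkt[unfolded f_eq] ranks rank(1)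
      _ _ sigma_max_bound[OF B], where \<alpha> = \<alpha>, folded f_eq]

  have ii: "quadratic_growth f Xs (eigval (rank Zs) Zs / 2)" if case_ii
    using quadratic_growth_if_rank_one[OF g_convex A_linear kkt[unfolded f_eq] ranks rank(1)] that
    by (simp add: case_ii_def f_eq)

  have i: "\<exists>\<gamma>. quadratic_growth f Xs \<gamma>" if i: case_i
  proof -
    have "face_space Xs \<subseteq> Sym"
      by (auto simp: face_space_def)
    then obtain l where "0 < l" "\<And>D. D \<in> face_space Xs \<Longrightarrow> l * norm D \<le> norm (with_trace A D)"
      using linear_on_Sym_injective_bound[OF B subspace_face_space _ inj[OF i]] by blast
    then show ?thesis
      using growth_i i by (auto simp: case_i_def)
  qed

  have i_V: "quadratic_growth f Xs
       (min (eigval (rank Zs) Zs /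
               (4 + 8 * ((sigma_max (with_trace A))\<^sup>2 / (sigma_min (compress (with_trace A) V))\<^sup>2)))
            (\<alpha> * (sigma_min (compress (with_trace A) V))\<^sup>2 / 8))"
    if case_i and V: "orthonormal_range_basis V Xs"
  proof (rule growth_i)
    have BV: "linear_on_Sym (compress (with_trace A) V)"
      using B by (rule linear_on_Sym_compress)
    show "strongly_convex \<alpha> g" "0 < \<alpha>"
      using \<open>case_i\<close> by (auto simp: case_i_def)
    show "0 < sigma_min (compress (with_trace A) V)"
    proof (rule sigma_min_pos[OF BV])
      fix S assume S: "S \<in> Sym" "compress (with_trace A) V S = 0"
      then have "V ** S ** transpose V = 0"
        using inj[OF \<open>case_i\<close>] face_space_parametrization(1)[OF V Xs] by (simp add: compress_def)
      then have "transpose V ** (V ** S ** transpose V) ** V = 0"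
        by (simp add: matrix_matrix_mult_def vec_eq_iff)
      moreover have "transpose V ** (V ** S ** transpose V) ** V
          = (transpose V ** V) ** S ** (transpose V ** V)"
        by (simp only: matrix_mul_assoc)
      ultimately show "S = 0"
        using V by (simp add: orthonormal_range_basis_def)
    qed
    show "sigma_min (compress (with_trace A) V) * norm D \<le> norm (with_trace A D)"
      if D: "D \<in> face_space Xs" for D
    proof -
      obtain S where "S \<in> Sym" "norm S = norm D" "V ** S ** transpose V = D"
        using face_space_parametrization(2)[OF V Xs D] by blast
      then show ?thesis
        using sigma_min_bound[OF BV, of S] by (simp add: compress_def)
    qed
  qed

  show ?thesis
    unfolding rank(2) using i ii i_V quadratic_growth_unique Xs_opt by blast
qed

end
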